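(* Let $u(t,y)$ be the mild solution of the one-dimensional stochastic heat equation with additive space-time white noise $\frac{\partial u}{\partial t}=\frac12\Delta u+\dot W$, $0<t\le T$, $y\in\mathbb{R}$, with $u(0,y)=0$ for $y\in\mathbb{R}$. For every $\alpha$ in $[0,1/4]$ and $\delta>0$, there is a finite random variable $c_{\alpha,\delta}$ depending on $\alpha$ and $\delta$ such that the following estimate holds almost surely: $$\sup_{|t-s|\le\delta,\,|x-y|\le\delta}\frac{|u(t,y)-u(t,x)-u(s,y)+u(s,x)|}{|t-s|^{\frac14-\alpha}\,|x-y|^{2\alpha}\,\left|\log\left(|t-s||x-y|\right)\right|^{\frac12}}\le c_{\alpha,\delta}.$$ Moreover, for some absolute constant $\kappa_{\alpha}$, the following inequality holds: $$\lim_{\delta\downarrow 0}\ \sup_{|t-s|\le\delta,\,|x-y|\le\delta}\frac{|u(t,y)-u(t,x)-u(s,y)+u(s,x)|}{|t-s|^{\frac14-\alpha}\,|x-y|^{2\alpha}\,\left|\log\left(|t-s||x-y|\right)\right|^{\frac12}}\le \kappa_{\alpha}.$$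
   Context: Here $\Delta u=\frac{\partial^2}{\partial y^2}u$, $W$ is a space-time standard Brownian sheet, and $\dot W=\frac{\partial^2}{\partial t\,\partial y}W$. With $p_t(y)=\frac{1}{\sqrt{2\pi t}}e^{-\frac{y^2}{2t}}$, the mild solution is $$u(t,y)=\int_0^t\int_{\mathbb{R}}p_{t-r}(y-z)\,W(dr,dz),$$ where the integral is the usual (Itô) stochastic integral, with a deterministic integrand; $u(t,y)$ is a mean zero Gaussian random field.
   Formalization: x,y range over an arbitrary compact interval [a,b] (over all of ℝ the sup is a.s. infinite), with κ independent of it; the first estimate is for δ such that log(|t−s||x−y|) never vanishes on the range (else the sup is infinite); u is a continuous version of the mild solution. *)

theory Defs
  imports "HOL-Probability.Probability"
begin

definition centred_gaussian :: "'a measure \<Rightarrow> ('a \<Rightarrow> real) \<Rightarrow> bool" where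
  "centred_gaussian M X \<longleftrightarrow> X \<in> borel_measurable M \<and>
     ((AE \<omega> in M. X \<omega> = 0) \<or> (\<exists>\<sigma>>0. distributed M lborel X (normal_density 0 \<sigma>)))"

definition centred_gaussian_field :: "'a measure \<Rightarrow> 'i set \<Rightarrow> ('i \<Rightarrow> 'a \<Rightarrow> real) \<Rightarrow> bool" where
  "centred_gaussian_field M I X \<longleftrightarrow>
     (\<forall>F c. finite F \<longrightarrow> F \<subseteq> I \<longrightarrow> centred_gaussian M (\<lambda>\<omega>. \<Sum>i\<in>F. c i * X i \<omega>))"

text \<open>Standard Brownian sheet with time parameter in \<open>[0, \<infinity>)\<close> and two-sided space parameter.
  The factor \<open>(\<bar>x\<bar> + \<bar>y\<bar> - \<bar>x - y\<bar>) / 2\<close> equals \<open>min \<bar>x\<bar> \<bar>y\<bar>\<close> if \<open>x\<close> and \<open>y\<close> have the same sign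
  and \<open>0\<close> otherwise.  Path continuity of the sheet plays no role in the stochastic integral
  and is not required.\<close>

definition brownian_sheet :: "'a measure \<Rightarrow> (real \<Rightarrow> real \<Rightarrow> 'a \<Rightarrow> real) \<Rightarrow> bool" where
  "brownian_sheet M W \<longleftrightarrow>
     centred_gaussian_field M ({0..} \<times> UNIV) (\<lambda>(t, y). W t y) \<and>
     (\<forall>s\<ge>0. \<forall>t\<ge>0. \<forall>x y.
        integral\<^sup>L M (\<lambda>\<omega>. W s x \<omega> * W t y \<omega>) = min s t * ((\<bar>x\<bar> + \<bar>y\<bar> - \<bar>x - y\<bar>) / 2))"

definition rect_increment :: "(real \<Rightarrow> real \<Rightarrow> 'a \<Rightarrow> real) \<Rightarrow> real \<Rightarrow> real \<Rightarrow> real \<Rightarrow> real \<Rightarrow> 'a \<Rightarrow> real" where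
  "rect_increment v s t x y \<omega> = v t y \<omega> - v t x \<omega> - v s y \<omega> + v s x \<omega>"

text \<open>A list of tuples \<open>(c, s, t, x, y)\<close> encodes the step function
  \<open>\<Sum> c * indicator ({s<..t} \<times> {x<..y})\<close> on \<open>[0, \<infinity>) \<times> \<real>\<close>.\<close>

type_synonym step = "(real \<times> real \<times> real \<times> real \<times> real) list"

definition valid_step :: "step \<Rightarrow> bool" where
  "valid_step \<phi> \<longleftrightarrow> (\<forall>(c, s, t, x, y)\<in>set \<phi>. 0 \<le> s \<and> s \<le> t \<and> x \<le> y)"

definition step_fun :: "step \<Rightarrow> real \<times> real \<Rightarrow> real" where
  "step_fun \<phi> p = (\<Sum>(c, s, t, x, y)\<leftarrow>\<phi>. c * indicator ({s<..t} \<times> {x<..y}) p)"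

definition step_integral :: "(real \<Rightarrow> real \<Rightarrow> 'a \<Rightarrow> real) \<Rightarrow> step \<Rightarrow> 'a \<Rightarrow> real" where
  "step_integral W \<phi> \<omega> = (\<Sum>(c, s, t, x, y)\<leftarrow>\<phi>. c * rect_increment W s t x y \<omega>)"

text \<open>\<open>X\<close> is a version of the stochastic integral \<open>\<integral>\<integral> f(r, z) W(dr, dz)\<close> of the deterministic
  square-integrable \<open>f\<close>: the \<open>L\<^sup>2\<close> limit of the integrals of step functions approximating \<open>f\<close> in
  \<open>L\<^sup>2\<close>.  As the integral is only determined almost surely, it is a relation.  The distances are
  nonnegative integrals, so that they are \<open>\<infinity>\<close> (and not \<open>0\<close>) for functions outside \<open>L\<^sup>2\<close>.\<close>

definition is_wiener_integral ::
  "'a measure \<Rightarrow> (real \<Rightarrow> real \<Rightarrow> 'a \<Rightarrow> real) \<Rightarrow> (real \<times> real \<Rightarrow> real) \<Rightarrow> ('a \<Rightarrow> real) \<Rightarrow> bool" where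
  "is_wiener_integral M W f X \<longleftrightarrow>
     f \<in> borel_measurable borel \<and> X \<in> borel_measurable M \<and>
     (\<exists>\<phi> :: nat \<Rightarrow> step. (\<forall>n. valid_step (\<phi> n)) \<and>
        (\<lambda>n. \<integral>\<^sup>+ p. ennreal ((f p - step_fun (\<phi> n) p)\<^sup>2) \<partial>lborel) \<longlonglongrightarrow> 0 \<and>
        (\<lambda>n. \<integral>\<^sup>+ \<omega>. ennreal ((X \<omega> - step_integral W (\<phi> n) \<omega>)\<^sup>2) \<partial>M) \<longlonglongrightarrow> 0)"

definition heat_kernel :: "real \<Rightarrow> real \<Rightarrow> real" where
  "heat_kernel t y = 1 / sqrt (2 * pi * t) * exp (- y\<^sup>2 / (2 * t))"

definition mild_solution ::
  "'a measure \<Rightarrow> (real \<Rightarrow> real \<Rightarrow> 'a \<Rightarrow> real) \<Rightarrow> real \<Rightarrow> (real \<Rightarrow> real \<Rightarrow> 'a \<Rightarrow> real) \<Rightarrow> bool" where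
  "mild_solution M W T u \<longleftrightarrow>
     (\<forall>t\<in>{0..T}. \<forall>y. is_wiener_integral M W
        (\<lambda>(r, z). if 0 \<le> r \<and> r < t then heat_kernel (t - r) (y - z) else 0) (u t y))"

text \<open>A mild solution is determined only up to modification at each \<open>(t, y)\<close>; pathwise suprema are
  meaningful for its continuous version.\<close>

definition continuous_paths ::
  "'a measure \<Rightarrow> real \<Rightarrow> (real \<Rightarrow> real \<Rightarrow> 'a \<Rightarrow> real) \<Rightarrow> bool" where
  "continuous_paths M T u \<longleftrightarrow>
     (AE \<omega> in M. continuous_on ({0..T} \<times> UNIV) (\<lambda>(t, y). u t y \<omega>))"

text \<open>The quotient below is \<open>0 / 0\<close> for \<open>s = t\<close> or \<open>x = y\<close>, so these points are left out of the
  range of the supremum.  The space variable runs through a bounded interval \<open>[a, b]\<close>: the solution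
  is stationary and mixing in space, so that over the whole line the supremum is almost surely
  infinite.  It is also infinite if \<open>\<bar>t - s\<bar> * \<bar>x - y\<bar> = 1\<close> occurs in the range, where the logarithm
  vanishes; estimates for a fixed \<open>\<delta>\<close> have to exclude this (it cannot happen for \<open>\<delta> < 1\<close>).\<close>

definition increment_range :: "real \<Rightarrow> real \<Rightarrow> real \<Rightarrow> real \<Rightarrow> (real \<times> real \<times> real \<times> real) set" where
  "increment_range T a b \<delta> = {(s, t, x, y).
     s \<in> {0..T} \<and> t \<in> {0..T} \<and> x \<in> {a..b} \<and> y \<in> {a..b} \<and>
     s \<noteq> t \<and> x \<noteq> y \<and> \<bar>t - s\<bar> \<le> \<delta> \<and> \<bar>x - y\<bar> \<le> \<delta>}"

definition increment_modulus ::
  "real \<Rightarrow> (real \<Rightarrow> real \<Rightarrow> 'a \<Rightarrow> real) \<Rightarrow> real \<Rightarrow> real \<Rightarrow> real \<Rightarrow> real \<Rightarrow> 'a \<Rightarrow> ereal" where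
  "increment_modulus \<alpha> u T a b \<delta> \<omega> =
     (SUP (s, t, x, y) \<in> increment_range T a b \<delta>.
        ereal (\<bar>rect_increment u s t x y \<omega>\<bar> /
          (\<bar>t - s\<bar> powr (1/4 - \<alpha>) * \<bar>x - y\<bar> powr (2 * \<alpha>) *
           \<bar>ln (\<bar>t - s\<bar> * \<bar>x - y\<bar>)\<bar> powr (1/2))))"

end

theory Submission
  imports Defs
begin

text \<open>The increment of \<open>u\<close> between \<open>(s, x)\<close> and \<open>(t, y)\<close> is Gaussian with variance at most a constant times
\<open>sqrt \<bar>t - s\<bar> + \<bar>x - y\<bar>\<close>, so on bounded sets \<open>u\<close> has, for the parabolic distance
\<open>\<rho> = max (sqrt \<bar>t - s\<bar>) \<bar>x - y\<bar>\<close>, almost surely the modulus of continuity \<open>sqrt (\<rho> * ln (1 / \<rho>))\<close>.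
No genuinely two-parameter estimate is needed on top of this. The rectangular increment is the
difference of two time increments of size \<open>\<bar>t - s\<bar>\<close>, and also the difference of two space increments
of size \<open>\<bar>x - y\<bar>\<close>. It is therefore bounded both by \<open>\<bar>t - s\<bar> powr (1/4)\<close> and by \<open>\<bar>x - y\<bar> powr (1/2)\<close>,
up to the square root of a logarithm, and the geometric mean of the two bounds with weights
\<open>1 - 4 * \<alpha>\<close> and \<open>4 * \<alpha>\<close> is the required one (\<open>interpolation_bound\<close>): for small distances
\<open>\<bar>ln (\<bar>t - s\<bar> * \<bar>x - y\<bar>)\<bar>\<close> dominates both \<open>ln (1 / \<bar>t - s\<bar>)\<close> and \<open>ln (1 / \<bar>x - y\<bar>)\<close>.

The modulus of continuity comes from three ingredients. Differences of Wiener integrals have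
Gaussian tails governed by the \<open>L\<^sup>2\<close> distance of the integrands (\<open>wiener_integral_diff_tail\<close>);
this follows from the isometry for step functions by approximation. The \<open>L\<^sup>2\<close> distance of two
integrands of the mild solution is computed with the semigroup property of the heat kernel
(\<open>heat_integrand_increment\<close>). Finally, a chaining argument along grids of mesh \<open>4 powr - n\<close> in time and
\<open>2 powr - n\<close> in space reduces the claim to increments between neighbouring grid points (\<open>chaining\<close>),
which are controlled by the Borel-Cantelli lemma (\<open>AE_grid_links\<close>). The horizon \<open>T\<close> and the
interval \<open>[a, b]\<close> enter only through the number of grid points, hence only through a factor that
leaves the series of probabilities summable. They influence the random level from which
the bounds hold, but not the constant in them, which is why \<open>\<kappa>\<close> is absolute.

The bound for a fixed \<open>\<delta>\<close> follows because away from the diagonals the quotient is controlled by the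
maximum of \<open>\<bar>u\<bar>\<close> on a compact set. The products \<open>\<bar>t - s\<bar> * \<bar>x - y\<bar>\<close> that occur fill an interval
\<open>(0, m]\<close>; as the logarithm vanishes nowhere on it, \<open>m < 1\<close>, and the logarithm is bounded away from
\<open>0\<close> (\<open>increment_range_log_gap\<close>).\<close>

section \<open>Gaussian tails\<close>

lemma centred_gaussian_square_integrable:
  assumes "prob_space M" "centred_gaussian M X"
  shows "integrable M (\<lambda>\<omega>. (X \<omega>)\<^sup>2)"
proof -
  interpret prob_space M by fact
  have meas [measurable]: "X \<in> borel_measurable M"
    using assms by (auto simp: centred_gaussian_def)
  consider "AE \<omega> in M. X \<omega> = 0" | \<sigma> where "\<sigma> > 0" "distributed M lborel X (normal_density 0 \<sigma>)"
    using assms by (auto simp: centred_gaussian_def)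
  then show ?thesis
  proof cases
    case 1
    then have "AE \<omega> in M. (X \<omega>)\<^sup>2 = 0" by auto
    then have "integrable M (\<lambda>\<omega>. (X \<omega>)\<^sup>2) \<longleftrightarrow> integrable M (\<lambda>\<omega>. 0::real)"
      by (intro integrable_cong_AE) auto
    then show ?thesis by simp
  next
    case 2
    then show ?thesis
      using distributed_integrable[OF 2(2), of "\<lambda>x. x\<^sup>2"] integrable_normal_moment[OF 2(1), of 0 2]
      by (simp add: distributed_def)
  qed
qed

text \<open>This is Markov's inequality for \<open>exp (X\<^sup>2 / (4 * \<sigma>\<^sup>2))\<close>: multiplying the density of \<open>X\<close> by this weight
gives \<open>sqrt 2\<close> times the density of a centred normal variable of variance \<open>2 * \<sigma>\<^sup>2\<close>, so the
expectation is \<open>sqrt 2\<close>.\<close>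

lemma centred_gaussian_tail:
  assumes "prob_space M" and gauss: "centred_gaussian M X"
    and var: "(\<integral>\<omega>. (X \<omega>)\<^sup>2 \<partial>M) \<le> v" and "v > 0" "l > 0"
  shows "measure M {\<omega>\<in>space M. l \<le> \<bar>X \<omega>\<bar>} \<le> sqrt 2 * exp (- l\<^sup>2 / (4 * v))"
proof -
  interpret prob_space M by fact
  have meas [measurable]: "X \<in> borel_measurable M"
    using gauss by (auto simp: centred_gaussian_def)
  consider "AE \<omega> in M. X \<omega> = 0" | \<sigma> where "\<sigma> > 0" "distributed M lborel X (normal_density 0 \<sigma>)"
    using gauss by (auto simp: centred_gaussian_def)
  then show ?thesis
  proof cases
    case 1
    then have "AE \<omega> in M. \<not> (l \<le> \<bar>X \<omega>\<bar>)" using \<open>l > 0\<close> by auto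
    then have "measure M {\<omega>\<in>space M. l \<le> \<bar>X \<omega>\<bar>} = 0"
      by (subst prob_eq_0) auto
    then show ?thesis by simp
  next
    case 2
    note \<sigma> = 2
    have sd: "(\<integral>\<omega>. (X \<omega>)\<^sup>2 \<partial>M) = \<sigma>\<^sup>2"
      using normal_distributed_variance[OF \<sigma>] normal_distributed_expectation[OF \<sigma>] by simp
    then have le: "\<sigma>\<^sup>2 \<le> v" using var by simp
    have dens: "normal_density 0 \<sigma> x * exp (x\<^sup>2 / (4 * \<sigma>\<^sup>2)) = sqrt 2 * normal_density 0 (sqrt 2 * \<sigma>) x" for x
    proof -
      have "exp (- x\<^sup>2 / (2 * \<sigma>\<^sup>2)) * exp (x\<^sup>2 / (4 * \<sigma>\<^sup>2)) = exp (- x\<^sup>2 / (4 * \<sigma>\<^sup>2))"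
        using \<open>\<sigma> > 0\<close> by (simp flip: exp_add add: field_simps)
      then show ?thesis using \<open>\<sigma> > 0\<close>
        by (simp add: normal_density_def power_mult_distrib real_sqrt_mult field_simps)
    qed
    have "(\<integral>\<^sup>+ \<omega>. ennreal (exp ((X \<omega>)\<^sup>2 / (4 * \<sigma>\<^sup>2))) \<partial>M)
        = (\<integral>\<^sup>+ x. ennreal (normal_density 0 \<sigma> x) * ennreal (exp (x\<^sup>2 / (4 * \<sigma>\<^sup>2))) \<partial>lborel)"
      using distributed_nn_integral[OF \<sigma>(2), of "\<lambda>x. ennreal (exp (x\<^sup>2 / (4 * \<sigma>\<^sup>2)))"] by simp
    also have "\<dots> = (\<integral>\<^sup>+ x. ennreal (sqrt 2) * ennreal (normal_density 0 (sqrt 2 * \<sigma>) x) \<partial>lborel)"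
      by (intro nn_integral_cong) (simp flip: ennreal_mult add: dens)
    also have "\<dots> = ennreal (sqrt 2)"
    proof -
      have "0 < sqrt 2 * \<sigma>" using \<open>\<sigma> > 0\<close> by simp
      then have "(\<integral>\<^sup>+ x. ennreal (normal_density 0 (sqrt 2 * \<sigma>) x) \<partial>lborel) = 1"
        using prob_space.emeasure_space_1[OF prob_space_normal_density[of "sqrt 2 * \<sigma>" 0]]
        by (simp add: emeasure_density)
      then show ?thesis by (subst nn_integral_cmult) auto
    qed
    finally have mgf: "(\<integral>\<^sup>+ \<omega>. ennreal (exp ((X \<omega>)\<^sup>2 / (4 * \<sigma>\<^sup>2))) \<partial>M) = ennreal (sqrt 2)" .
    have "emeasure M {\<omega>\<in>space M. 1 \<le> ennreal (exp (- l\<^sup>2 / (4 * \<sigma>\<^sup>2))) * ennreal (exp ((X \<omega>)\<^sup>2 / (4 * \<sigma>\<^sup>2)))}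
       \<le> ennreal (exp (- l\<^sup>2 / (4 * \<sigma>\<^sup>2))) * ennreal (sqrt 2)"
      using nn_integral_Markov_inequality[of "\<lambda>\<omega>. ennreal (exp ((X \<omega>)\<^sup>2 / (4 * \<sigma>\<^sup>2)))" "space M" M "ennreal (exp (- l\<^sup>2 / (4 * \<sigma>\<^sup>2)))"]
      by (simp add: mgf cong: nn_integral_cong_simp)
    also have "{\<omega>\<in>space M. 1 \<le> ennreal (exp (- l\<^sup>2 / (4 * \<sigma>\<^sup>2))) * ennreal (exp ((X \<omega>)\<^sup>2 / (4 * \<sigma>\<^sup>2)))}
        = {\<omega>\<in>space M. l \<le> \<bar>X \<omega>\<bar>}"
    proof -
      have "1 \<le> ennreal (exp (- l\<^sup>2 / (4 * \<sigma>\<^sup>2))) * ennreal (exp (x\<^sup>2 / (4 * \<sigma>\<^sup>2))) \<longleftrightarrow> l \<le> \<bar>x\<bar>" for x :: real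
      proof -
        have "1 \<le> ennreal (exp (- l\<^sup>2 / (4 * \<sigma>\<^sup>2))) * ennreal (exp (x\<^sup>2 / (4 * \<sigma>\<^sup>2)))
           \<longleftrightarrow> 1 \<le> exp ((x\<^sup>2 - l\<^sup>2) / (4 * \<sigma>\<^sup>2))"
          by (simp flip: ennreal_mult exp_add ennreal_1 add: diff_divide_distrib)
        also have "\<dots> \<longleftrightarrow> l\<^sup>2 \<le> x\<^sup>2" using \<open>\<sigma> > 0\<close> by (simp add: zero_le_divide_iff)
        also have "\<dots> \<longleftrightarrow> l \<le> \<bar>x\<bar>" using \<open>l > 0\<close> by (simp flip: abs_le_square_iff)
        finally show ?thesis .
      qed
      then show ?thesis by simp
    qed
    finally have "measure M {\<omega>\<in>space M. l \<le> \<bar>X \<omega>\<bar>} \<le> exp (- l\<^sup>2 / (4 * \<sigma>\<^sup>2)) * sqrt 2"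
      by (simp add: emeasure_eq_measure flip: ennreal_mult)
    also have "\<dots> \<le> exp (- l\<^sup>2 / (4 * v)) * sqrt 2"
    proof -
      have "l\<^sup>2 / (4 * v) \<le> l\<^sup>2 / (4 * \<sigma>\<^sup>2)"
        using le \<open>\<sigma> > 0\<close> \<open>v > 0\<close> by (intro divide_left_mono) auto
      then show ?thesis by simp
    qed
    finally show ?thesis by (simp add: mult.commute)
  qed
qed

section \<open>The isometry for step functions\<close>

text \<open>The length of the intersection of \<open>(s, t]\<close> and \<open>(s', t']\<close>. The covariance of the sheet is a product of
a function of the times and a function of the positions, and the rectangular differences of both
factors are overlaps.\<close>

definition overlap :: "real \<Rightarrow> real \<Rightarrow> real \<Rightarrow> real \<Rightarrow> real" where
  "overlap s t s' t' = max 0 (min t t' - max s s')"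

lemma rectangular_difference_min:
  fixes s t s' t' :: real
  assumes "s \<le> t" "s' \<le> t'"
  shows "min t t' - min t s' - min s t' + min s s' = overlap s t s' t'"
  using assms unfolding overlap_def min_def max_def by auto

lemma rectangular_difference_abs:
  fixes x y x' y' :: real
  assumes "x \<le> y" "x' \<le> y'"
  shows "(\<bar>y - x'\<bar> + \<bar>x - y'\<bar> - \<bar>y - y'\<bar> - \<bar>x - x'\<bar>) / 2 = overlap x y x' y'"
  using assms unfolding overlap_def min_def max_def abs_if by auto

lemma brownian_sheet_square_integrable:
  assumes "prob_space M" "brownian_sheet M W" "t \<ge> 0"
  shows "W t y \<in> borel_measurable M" "integrable M (\<lambda>\<omega>. (W t y \<omega>)\<^sup>2)"
proof -
  have "centred_gaussian M (\<lambda>\<omega>. \<Sum>i\<in>{(t, y)}. 1 * (case i of (t, y) \<Rightarrow> W t y) \<omega>)"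
    using assms unfolding brownian_sheet_def centred_gaussian_field_def
    by (elim conjE allE[where x="{(t, y)}"] allE[where x="\<lambda>_. 1"]) auto
  then have g: "centred_gaussian M (W t y)" by simp
  then show "W t y \<in> borel_measurable M" by (simp add: centred_gaussian_def)
  show "integrable M (\<lambda>\<omega>. (W t y \<omega>)\<^sup>2)"
    by (rule centred_gaussian_square_integrable[OF assms(1) g])
qed

lemma has_bochner_integral_sheet_product:
  assumes "prob_space M" "brownian_sheet M W" "s \<ge> 0" "t \<ge> 0"
  shows "has_bochner_integral M (\<lambda>\<omega>. W s x \<omega> * W t y \<omega>)
           (min s t * ((\<bar>x\<bar> + \<bar>y\<bar> - \<bar>x - y\<bar>) / 2))"
proof -
  note [measurable] = brownian_sheet_square_integrable(1)[OF assms(1,2)]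
  have [measurable]: "W s x \<in> borel_measurable M" "W t y \<in> borel_measurable M"
    using assms by measurable
  have sq: "integrable M (\<lambda>\<omega>. (W s x \<omega>)\<^sup>2 + (W t y \<omega>)\<^sup>2)"
    using assms by (intro Bochner_Integration.integrable_add brownian_sheet_square_integrable) auto
  have "integrable M (\<lambda>\<omega>. W s x \<omega> * W t y \<omega>)"
  proof (rule Bochner_Integration.integrable_bound[OF sq])
    have "\<bar>p * q\<bar> \<le> p\<^sup>2 + q\<^sup>2" for p q :: real
    proof -
      have "2 * \<bar>p * q\<bar> \<le> p\<^sup>2 + q\<^sup>2"
        using sum_squares_bound[of "\<bar>p\<bar>" "\<bar>q\<bar>"] by (simp add: abs_mult mult.assoc)
      then show ?thesis by simp
    qed
    then show "AE \<omega> in M. norm (W s x \<omega> * W t y \<omega>) \<le> norm ((W s x \<omega>)\<^sup>2 + (W t y \<omega>)\<^sup>2)"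
      by simp
  qed measurable
  moreover have "integral\<^sup>L M (\<lambda>\<omega>. W s x \<omega> * W t y \<omega>) = min s t * ((\<bar>x\<bar> + \<bar>y\<bar> - \<bar>x - y\<bar>) / 2)"
    using assms by (simp add: brownian_sheet_def)
  ultimately show ?thesis by (simp add: has_bochner_integral_iff)
qed

text \<open>Covariances of rectangular increments arise from those of the sheet by applying this once in each
of the two factors.\<close>

lemma has_bochner_integral_rect_increment_mult:
  assumes "\<And>t y. t \<ge> 0 \<Longrightarrow> has_bochner_integral M (\<lambda>\<omega>. W t y \<omega> * Z \<omega>) (g t y)" "s \<ge> 0" "t \<ge> 0"
  shows "has_bochner_integral M (\<lambda>\<omega>. rect_increment W s t x y \<omega> * Z \<omega>)
          (g t y - g t x - g s y + (g s x :: real))"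
  unfolding rect_increment_def ring_distribs
  by (intro has_bochner_integral_add has_bochner_integral_diff assms)

lemma rect_increment_covariance:
  assumes "prob_space M" "brownian_sheet M W"
    and "0 \<le> s" "s \<le> t" "x \<le> y" "0 \<le> s'" "s' \<le> t'" "x' \<le> y'"
  shows "has_bochner_integral M (\<lambda>\<omega>. rect_increment W s t x y \<omega> * rect_increment W s' t' x' y' \<omega>)
           (overlap s t s' t' * overlap x y x' y')"
proof -
  define m where "m = (\<lambda>(t::real) (t'::real). min t t')"
  define q where "q = (\<lambda>(y::real) y'. (\<bar>y\<bar> + \<bar>y'\<bar> - \<bar>y - y'\<bar>) / 2)"
  have one: "has_bochner_integral M (\<lambda>\<omega>. rect_increment W s' t' x' y' \<omega> * W \<tau> \<eta> \<omega>)
     (m t' \<tau> * q y' \<eta> - m t' \<tau> * q x' \<eta> - m s' \<tau> * q y' \<eta> + m s' \<tau> * q x' \<eta>)" if "\<tau> \<ge> 0" for \<tau> \<eta>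
    using has_bochner_integral_sheet_product[OF assms(1,2)] assms that unfolding m_def q_def
    by (intro has_bochner_integral_rect_increment_mult[where g="\<lambda>t y. min t \<tau> * ((\<bar>y\<bar> + \<bar>\<eta>\<bar> - \<bar>y - \<eta>\<bar>) / 2)"]) auto
  have "has_bochner_integral M (\<lambda>\<omega>. rect_increment W s t x y \<omega> * rect_increment W s' t' x' y' \<omega>)
     ((m t' t * q y' y - m t' t * q x' y - m s' t * q y' y + m s' t * q x' y)
      - (m t' t * q y' x - m t' t * q x' x - m s' t * q y' x + m s' t * q x' x)
      - (m t' s * q y' y - m t' s * q x' y - m s' s * q y' y + m s' s * q x' y)
      + (m t' s * q y' x - m t' s * q x' x - m s' s * q y' x + m s' s * q x' x))"
    using one assms
    by (intro has_bochner_integral_rect_increment_mult[where g="\<lambda>\<tau> \<eta>. m t' \<tau> * q y' \<eta> - m t' \<tau> * q x' \<eta> - m s' \<tau> * q y' \<eta> + m s' \<tau> * q x' \<eta>"])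
       (auto simp: mult.commute[of "W _ _ _"])
  also have "((m t' t * q y' y - m t' t * q x' y - m s' t * q y' y + m s' t * q x' y)
      - (m t' t * q y' x - m t' t * q x' x - m s' t * q y' x + m s' t * q x' x)
      - (m t' s * q y' y - m t' s * q x' y - m s' s * q y' y + m s' s * q x' y)
      + (m t' s * q y' x - m t' s * q x' x - m s' s * q y' x + m s' s * q x' x))
     = (m t t' - m t s' - m s t' + m s s') * (q y' y - q x' y - q y' x + q x' x)"
    unfolding m_def by (simp add: min.commute algebra_simps)
  also have "q y' y - q x' y - q y' x + q x' x = (\<bar>y - x'\<bar> + \<bar>x - y'\<bar> - \<bar>y - y'\<bar> - \<bar>x - x'\<bar>) / 2"
    unfolding q_def by (simp add: abs_minus_commute diff_divide_distrib add_divide_distrib)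
  also have "\<dots> = overlap x y x' y'" by (rule rectangular_difference_abs) fact+
  also have "m t t' - m t s' - m s t' + m s s' = overlap s t s' t'"
    unfolding m_def by (rule rectangular_difference_min) fact+
  finally show ?thesis .
qed

lemma rectangle_inner_product:
  fixes s t x y :: real
  shows "has_bochner_integral lborel
    (\<lambda>p. indicator ({s<..t} \<times> {x<..y}) p * (indicator ({s'<..t'} \<times> {x'<..y'}) p :: real))
    (overlap s t s' t' * overlap x y x' y')"
proof -
  have Ioc: "emeasure lborel {p<..q} = ennreal (max 0 (q - p))" for p q :: real
    by (cases "p \<le> q") auto
  have em: "emeasure lborel {max a b<..min c d} = ennreal (overlap a c b d)" for a b c d :: real
    unfolding overlap_def by (rule Ioc)
  have "emeasure (lborel \<Otimes>\<^sub>M lborel) ({max s s'<..min t t'} \<times> {max x x'<..min y y'})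
    = emeasure lborel {max s s'<..min t t'} * emeasure lborel {max x x'<..min y y'}"
    by (rule lborel.emeasure_pair_measure_Times) simp_all
  then have "emeasure lborel ({max s s'<..min t t'} \<times> {max x x'<..min y y'})
      = ennreal (overlap s t s' t') * ennreal (overlap x y x' y')"
    by (simp only: lborel_prod em)
  also have "\<dots> = ennreal (overlap s t s' t' * overlap x y x' y')"
    by (simp add: overlap_def ennreal_mult)
  finally have em2: "emeasure lborel ({max s s'<..min t t'} \<times> {max x x'<..min y y'})
      = ennreal (overlap s t s' t' * overlap x y x' y')" .
  moreover have "{max s s'<..min t t'} \<times> {max x x'<..min y y'} \<in> sets lborel"
    using borel_Times[of "{max s s'<..min t t'}" "{max x x'<..min y y'}"] by simp
  moreover have "measure lborel ({max s s'<..min t t'} \<times> {max x x'<..min y y'}) = overlap s t s' t' * overlap x y x' y'"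
    unfolding measure_def em2 by (simp add: overlap_def)
  ultimately have "has_bochner_integral lborel (indicator ({max s s'<..min t t'} \<times> {max x x'<..min y y'}) :: _ \<Rightarrow> real)
      (overlap s t s' t' * overlap x y x' y')"
    using has_bochner_integral_real_indicator[of "{max s s'<..min t t'} \<times> {max x x'<..min y y'}" "lborel :: (real \<times> real) measure"]
    by (simp only: ennreal_less_top infinity_ennreal_def)
  moreover have "indicator ({s<..t} \<times> {x<..y}) p * (indicator ({s'<..t'} \<times> {x'<..y'}) p :: real)
      = indicator ({max s s'<..min t t'} \<times> {max x x'<..min y y'}) p" for p
    by (simp only: Int_greaterThanAtMost[symmetric] Times_Int_Times[symmetric] indicator_inter_arith)
  ultimately show ?thesis by simp
qed

definition step_inner :: "step \<Rightarrow> step \<Rightarrow> real" where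
  "step_inner \<phi> \<psi> = (\<Sum>(c, s, t, x, y)\<leftarrow>\<phi>. \<Sum>(c', s', t', x', y')\<leftarrow>\<psi>.
      c * (c' * (overlap s t s' t' * overlap x y x' y')))"

text \<open>The isometry compares two bilinear forms, the covariance of step integrals and the inner product of
step functions. Both are determined by their values on rectangles, where both are products of
overlaps; so one computation, with \<open>R\<close> either the increments of the sheet or the indicators, covers
both.\<close>

lemma step_inner_product:
  fixes R :: "real \<Rightarrow> real \<Rightarrow> real \<Rightarrow> real \<Rightarrow> 'b \<Rightarrow> real"
  assumes R: "\<And>s t x y s' t' x' y'. 0 \<le> s \<Longrightarrow> s \<le> t \<Longrightarrow> x \<le> y \<Longrightarrow> 0 \<le> s' \<Longrightarrow> s' \<le> t' \<Longrightarrow> x' \<le> y' \<Longrightarrow>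
      has_bochner_integral N (\<lambda>p. R s t x y p * R s' t' x' y' p) (overlap s t s' t' * overlap x y x' y')"
    and "valid_step \<phi>" "valid_step \<psi>"
  shows "has_bochner_integral N (\<lambda>p. (\<Sum>(c, s, t, x, y)\<leftarrow>\<phi>. c * R s t x y p)
      * (\<Sum>(c, s, t, x, y)\<leftarrow>\<psi>. c * R s t x y p)) (step_inner \<phi> \<psi>)"
proof -
  have one: "has_bochner_integral N (\<lambda>p. R s t x y p * (\<Sum>(c, s, t, x, y)\<leftarrow>\<psi>. c * R s t x y p))
      (\<Sum>(c', s', t', x', y')\<leftarrow>\<psi>. c' * (overlap s t s' t' * overlap x y x' y'))"
    if "valid_step \<psi>" "0 \<le> s" "s \<le> t" "x \<le> y" for s t x y \<psi>
    using that(1)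
  proof (induction \<psi>)
    case Nil
    show ?case by (simp add: has_bochner_integral_zero)
  next
    case (Cons e \<psi>)
    obtain c' s' t' x' y' where e: "e = (c', s', t', x', y')" by (cases e)
    have v: "valid_step \<psi>" "0 \<le> s'" "s' \<le> t'" "x' \<le> y'" using Cons.prems by (auto simp: valid_step_def e)
    have "has_bochner_integral N (\<lambda>p. c' * (R s t x y p * R s' t' x' y' p)
        + R s t x y p * (\<Sum>(c, s, t, x, y)\<leftarrow>\<psi>. c * R s t x y p))
       (c' * (overlap s t s' t' * overlap x y x' y') + (\<Sum>(c', s', t', x', y')\<leftarrow>\<psi>. c' * (overlap s t s' t' * overlap x y x' y')))"
      using that v by (intro has_bochner_integral_add has_bochner_integral_mult_right R Cons.IH) auto
    then show ?case by (simp add: e algebra_simps)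
  qed
  show ?thesis using assms(2)
  proof (induction \<phi>)
    case Nil
    show ?case by (simp add: has_bochner_integral_zero step_inner_def)
  next
    case (Cons e \<phi>)
    obtain c s t x y where e: "e = (c, s, t, x, y)" by (cases e)
    have v: "valid_step \<phi>" "0 \<le> s" "s \<le> t" "x \<le> y" using Cons.prems by (auto simp: valid_step_def e)
    have "has_bochner_integral N (\<lambda>p. c * (R s t x y p * (\<Sum>(c, s, t, x, y)\<leftarrow>\<psi>. c * R s t x y p))
        + (\<Sum>(c, s, t, x, y)\<leftarrow>\<phi>. c * R s t x y p) * (\<Sum>(c, s, t, x, y)\<leftarrow>\<psi>. c * R s t x y p))
       (c * (\<Sum>(c', s', t', x', y')\<leftarrow>\<psi>. c' * (overlap s t s' t' * overlap x y x' y')) + step_inner \<phi> \<psi>)"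
      using v \<open>valid_step \<psi>\<close> by (intro has_bochner_integral_add has_bochner_integral_mult_right one Cons.IH) auto
    moreover have "c * (\<Sum>(c', s', t', x', y')\<leftarrow>\<psi>. c' * (overlap s t s' t' * overlap x y x' y')) + step_inner \<phi> \<psi>
      = step_inner (e # \<phi>) \<psi>"
      by (simp add: step_inner_def e sum_list_const_mult[symmetric] case_prod_unfold)
    ultimately show ?case by (simp add: e algebra_simps)
  qed
qed

lemma step_integral_isometry:
  assumes "prob_space M" "brownian_sheet M W" "valid_step \<phi>"
  shows "(\<integral>\<^sup>+ p. ennreal ((step_fun \<phi> p)\<^sup>2) \<partial>lborel) = ennreal (\<integral>\<omega>. (step_integral W \<phi> \<omega>)\<^sup>2 \<partial>M)"
proof -
  have "has_bochner_integral M (\<lambda>\<omega>. step_integral W \<phi> \<omega> * step_integral W \<phi> \<omega>) (step_inner \<phi> \<phi>)"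
    unfolding step_integral_def
    by (intro step_inner_product rect_increment_covariance assms)
  moreover have *: "has_bochner_integral lborel (\<lambda>p. step_fun \<phi> p * step_fun \<phi> p) (step_inner \<phi> \<phi>)"
    unfolding step_fun_def
    by (intro step_inner_product[where R="\<lambda>s t x y p. indicator ({s<..t} \<times> {x<..y}) p"]
         rectangle_inner_product assms)
  ultimately show ?thesis
    using nn_integral_eq_integral[OF integrable.intros[OF *]]
    by (simp add: power2_eq_square has_bochner_integral_iff)
qed

text \<open>The definition of a Gaussian field speaks of sums over sets of distinct indices, whereas the
rectangles of a step function may share corners. Coefficients therefore have to be collected when
the corners of one more rectangle are added.\<close>

lemma sheet_combination_add:
  assumes "finite F" "F \<subseteq> I" "finite G" "G \<subseteq> I"
  shows "\<exists>H e. finite H \<and> H \<subseteq> I \<and> (\<forall>\<omega>. (\<Sum>i\<in>F. c i * X i \<omega>) + a * (\<Sum>i\<in>G. d i * X i \<omega>)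
     = (\<Sum>i\<in>H. e i * (X i \<omega> :: real)))"
proof (intro exI conjI allI)
  show "finite (F \<union> G)" "F \<union> G \<subseteq> I" using assms by auto
  fix \<omega>
  have "(\<Sum>i\<in>F. c i * X i \<omega>) = (\<Sum>i\<in>F \<union> G. (if i \<in> F then c i else 0) * X i \<omega>)"
    using assms by (intro sum.mono_neutral_cong_left) auto
  moreover have "(\<Sum>i\<in>G. d i * X i \<omega>) = (\<Sum>i\<in>F \<union> G. (if i \<in> G then d i else 0) * X i \<omega>)"
    using assms by (intro sum.mono_neutral_cong_left) auto
  ultimately show "(\<Sum>i\<in>F. c i * X i \<omega>) + a * (\<Sum>i\<in>G. d i * X i \<omega>)
     = (\<Sum>i\<in>F \<union> G. ((if i \<in> F then c i else 0) + a * (if i \<in> G then d i else 0)) * X i \<omega>)"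
    by (simp add: sum_distrib_left sum.distrib[symmetric] algebra_simps del: if_distribR)
qed

lemma step_integral_gaussian:
  assumes "brownian_sheet M W" "valid_step \<phi>"
  shows "centred_gaussian M (step_integral W \<phi>)"
proof -
  define I :: "(real \<times> real) set" where "I = {0..} \<times> UNIV"
  define X where "X = (\<lambda>i. case i of (t, y) \<Rightarrow> W t y)"
  have comb: "\<exists>F c. finite F \<and> F \<subseteq> I \<and> (\<forall>\<omega>. step_integral W \<phi> \<omega> = (\<Sum>i\<in>F. c i * X i \<omega>))"
    using assms(2)
  proof (induction \<phi>)
    case Nil
    show ?case by (intro exI[of _ "{}"]) (auto simp: step_integral_def)
  next
    case (Cons e \<phi>)
    obtain a s t x y where e: "e = (a, s, t, x, y)" by (cases e)
    have v: "valid_step \<phi>" "0 \<le> s" "s \<le> t" using Cons.prems by (auto simp: valid_step_def e)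
    have add: "\<exists>F c. finite F \<and> F \<subseteq> I \<and> (\<forall>\<omega>. Z \<omega> + b * W \<tau> \<eta> \<omega> = (\<Sum>i\<in>F. c i * X i \<omega>))"
      if Z: "\<exists>F c. finite F \<and> F \<subseteq> I \<and> (\<forall>\<omega>. Z \<omega> = (\<Sum>i\<in>F. c i * X i \<omega>))" and "\<tau> \<ge> 0" for Z b \<tau> \<eta>
    proof -
      obtain F c where F: "finite F" "F \<subseteq> I" "\<And>\<omega>. Z \<omega> = (\<Sum>i\<in>F. c i * X i \<omega>)" using Z by blast
      have "{(\<tau>, \<eta>)} \<subseteq> I" using that by (auto simp: I_def)
      from sheet_combination_add[OF F(1,2) _ this, of c X b "\<lambda>_. 1"] show ?thesis
        by (simp add: F(3)) (simp add: X_def)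
    qed
    have "\<exists>F c. finite F \<and> F \<subseteq> I \<and> (\<forall>\<omega>. step_integral W \<phi> \<omega> + a * W t y \<omega> + (- a) * W t x \<omega> + (- a) * W s y \<omega>
       + a * W s x \<omega> = (\<Sum>i\<in>F. c i * X i \<omega>))"
      using v by (intro add Cons.IH) auto
    moreover have "step_integral W (e # \<phi>) \<omega> = step_integral W \<phi> \<omega> + a * W t y \<omega> + (- a) * W t x \<omega> + (- a) * W s y \<omega>
       + a * W s x \<omega>" for \<omega>
      by (simp add: step_integral_def e rect_increment_def algebra_simps)
    ultimately show ?case by simp
  qed
  then obtain F c where F: "finite F" "F \<subseteq> I" "\<And>\<omega>. step_integral W \<phi> \<omega> = (\<Sum>i\<in>F. c i * X i \<omega>)"
    by blast
  then have "step_integral W \<phi> = (\<lambda>\<omega>. \<Sum>i\<in>F. c i * X i \<omega>)" by auto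
  with F assms(1) show ?thesis
    by (simp add: brownian_sheet_def centred_gaussian_field_def X_def I_def)
qed

definition step_diff :: "step \<Rightarrow> step \<Rightarrow> step" where
  "step_diff \<phi> \<psi> = \<phi> @ map (\<lambda>(c, r). (- c, r)) \<psi>"

lemma step_diff:
  shows "valid_step \<phi> \<Longrightarrow> valid_step \<psi> \<Longrightarrow> valid_step (step_diff \<phi> \<psi>)"
    and "step_fun (step_diff \<phi> \<psi>) p = step_fun \<phi> p - step_fun \<psi> p"
    and "step_integral W (step_diff \<phi> \<psi>) \<omega> = step_integral W \<phi> \<omega> - step_integral W \<psi> \<omega>"
proof -
  show "valid_step (step_diff \<phi> \<psi>)" if "valid_step \<phi>" "valid_step \<psi>"
    using that by (fastforce simp: valid_step_def step_diff_def)
  have "step_fun (map (\<lambda>(c, r). (- c, r)) \<psi>) p = - step_fun \<psi> p"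
    by (induction \<psi>) (auto simp: step_fun_def)
  then show "step_fun (step_diff \<phi> \<psi>) p = step_fun \<phi> p - step_fun \<psi> p"
    by (simp add: step_fun_def step_diff_def)
  have "step_integral W (map (\<lambda>(c, r). (- c, r)) \<psi>) \<omega> = - step_integral W \<psi> \<omega>"
    by (induction \<psi>) (auto simp: step_integral_def)
  then show "step_integral W (step_diff \<phi> \<psi>) \<omega> = step_integral W \<phi> \<omega> - step_integral W \<psi> \<omega>"
    by (simp add: step_integral_def step_diff_def)
qed

section \<open>Gaussian tails of Wiener integrals\<close>

text \<open>The middle term will be the quantity to estimate; the outer ones are approximation errors that tend
to \<open>0\<close> and can afford the larger weight.\<close>

lemma square_sum3_le:
  fixes a b c :: real
  shows "(a + b + c)\<^sup>2 \<le> 2 * b\<^sup>2 + 4 * a\<^sup>2 + 4 * c\<^sup>2"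
proof -
  have "2 * b\<^sup>2 + 4 * a\<^sup>2 + 4 * c\<^sup>2 - (a + b + c)\<^sup>2 = (b - (a + c))\<^sup>2 + 2 * (a - c)\<^sup>2"
    by (simp add: power2_eq_square algebra_simps)
  then show ?thesis by (smt (verit) zero_le_power2)
qed

lemma step_fun_measurable [measurable]: "step_fun \<phi> \<in> borel_measurable borel"
proof -
  have "(\<lambda>p. \<Sum>(c, s, t, x, y)\<leftarrow>\<phi>. c * indicator ({s<..t} \<times> {x<..y}) p :: real) \<in> borel_measurable borel"
  proof (induction \<phi>)
    case (Cons e \<phi>)
    obtain c s t x y where e: "e = (c, s, t, x, y)" by (cases e)
    have "{s<..t} \<times> {x<..y} \<in> sets borel" by (intro borel_Times) auto
    then have "(indicator ({s<..t} \<times> {x<..y}) :: _ \<Rightarrow> real) \<in> borel_measurable borel" by simp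
    then show ?case using Cons by (simp add: e)
  qed simp
  then show ?thesis unfolding step_fun_def[abs_def] .
qed

lemma nn_integral_square_sum3_le:
  assumes [measurable]: "a \<in> borel_measurable N" "b \<in> borel_measurable N" "c \<in> borel_measurable N"
  shows "(\<integral>\<^sup>+ x. ennreal ((a x + b x + c x)\<^sup>2) \<partial>N) \<le> 2 * (\<integral>\<^sup>+ x. ennreal ((b x)\<^sup>2) \<partial>N)
     + 4 * (\<integral>\<^sup>+ x. ennreal ((a x)\<^sup>2) \<partial>N) + 4 * (\<integral>\<^sup>+ x. ennreal ((c x)\<^sup>2) \<partial>N)"
proof -
  have "(\<integral>\<^sup>+ x. ennreal ((a x + b x + c x)\<^sup>2) \<partial>N)
     \<le> (\<integral>\<^sup>+ x. 2 * ennreal ((b x)\<^sup>2) + 4 * ennreal ((a x)\<^sup>2) + 4 * ennreal ((c x)\<^sup>2) \<partial>N)"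
  proof (rule nn_integral_mono)
    fix x
    have "ennreal ((a x + b x + c x)\<^sup>2) \<le> ennreal (2 * (b x)\<^sup>2 + 4 * (a x)\<^sup>2 + 4 * (c x)\<^sup>2)"
      by (intro ennreal_leI square_sum3_le)
    then show "ennreal ((a x + b x + c x)\<^sup>2) \<le> 2 * ennreal ((b x)\<^sup>2) + 4 * ennreal ((a x)\<^sup>2) + 4 * ennreal ((c x)\<^sup>2)"
      by (simp add: ennreal_mult'' ennreal_plus)
  qed
  also have "\<dots> = 2 * (\<integral>\<^sup>+ x. ennreal ((b x)\<^sup>2) \<partial>N)
     + 4 * (\<integral>\<^sup>+ x. ennreal ((a x)\<^sup>2) \<partial>N) + 4 * (\<integral>\<^sup>+ x. ennreal ((c x)\<^sup>2) \<partial>N)"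
    by (simp add: nn_integral_add nn_integral_cmult)
  finally show ?thesis .
qed

lemma second_moment_tail:
  assumes [measurable]: "Z \<in> borel_measurable M" and "l > 0"
  shows "emeasure M {\<omega>\<in>space M. l \<le> \<bar>Z \<omega>\<bar>} \<le> ennreal (1 / l\<^sup>2) * (\<integral>\<^sup>+ \<omega>. ennreal ((Z \<omega>)\<^sup>2) \<partial>M)"
proof -
  have "1 \<le> ennreal (1 / l\<^sup>2) * ennreal (z\<^sup>2) \<longleftrightarrow> l \<le> \<bar>z\<bar>" for z
  proof -
    have "1 \<le> ennreal (1 / l\<^sup>2) * ennreal (z\<^sup>2) \<longleftrightarrow> 1 \<le> 1 / l\<^sup>2 * z\<^sup>2"
      by (simp flip: ennreal_mult ennreal_1 del: times_divide_eq_left)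
    also have "\<dots> \<longleftrightarrow> l\<^sup>2 \<le> z\<^sup>2" using \<open>l > 0\<close> by (simp add: field_simps)
    also have "\<dots> \<longleftrightarrow> l \<le> \<bar>z\<bar>" using \<open>l > 0\<close> by (simp flip: abs_le_square_iff)
    finally show ?thesis .
  qed
  then have "{\<omega>\<in>space M. l \<le> \<bar>Z \<omega>\<bar>} = {\<omega>\<in>space M. 1 \<le> ennreal (1 / l\<^sup>2) * ennreal ((Z \<omega>)\<^sup>2)}" by simp
  then show ?thesis
    using nn_integral_Markov_inequality[of "\<lambda>\<omega>. ennreal ((Z \<omega>)\<^sup>2)" "space M" M "ennreal (1 / l\<^sup>2)"]
    by (simp cong: nn_integral_cong_simp)
qed

text \<open>The tail bound passes to the \<open>L\<^sup>2\<close> limit without identifying the limit distribution. Half of the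
threshold \<open>l\<close> is given to the difference \<open>D n\<close> of the approximating step integrals, which is Gaussian
and by the isometry eventually of variance at most \<open>3 * v\<close>; this gives the exponent
\<open>(l / 2)\<^sup>2 / (4 * (3 * v)) = l\<^sup>2 / (48 * v)\<close>. The other half is given to the error, whose second moment
tends to \<open>0\<close>.\<close>

lemma wiener_integral_diff_tail:
  assumes "prob_space M" and sheet: "brownian_sheet M W"
    and X: "is_wiener_integral M W f X" and Y: "is_wiener_integral M W g Y"
    and dist: "(\<integral>\<^sup>+ p. ennreal ((f p - g p)\<^sup>2) \<partial>lborel) \<le> ennreal v"
    and "v > 0" "l > 0"
  shows "measure M {\<omega>\<in>space M. l \<le> \<bar>X \<omega> - Y \<omega>\<bar>} \<le> sqrt 2 * exp (- l\<^sup>2 / (48 * v))"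
proof -
  interpret prob_space M by fact
  from X obtain \<phi> where \<phi>: "\<And>n. valid_step (\<phi> n)"
    "(\<lambda>n. \<integral>\<^sup>+ p. ennreal ((f p - step_fun (\<phi> n) p)\<^sup>2) \<partial>lborel) \<longlonglongrightarrow> 0"
    "(\<lambda>n. \<integral>\<^sup>+ \<omega>. ennreal ((X \<omega> - step_integral W (\<phi> n) \<omega>)\<^sup>2) \<partial>M) \<longlonglongrightarrow> 0"
    and [measurable]: "f \<in> borel_measurable borel" "X \<in> borel_measurable M"
    by (auto simp: is_wiener_integral_def)
  from Y obtain \<psi> where \<psi>: "\<And>n. valid_step (\<psi> n)"
    "(\<lambda>n. \<integral>\<^sup>+ p. ennreal ((g p - step_fun (\<psi> n) p)\<^sup>2) \<partial>lborel) \<longlonglongrightarrow> 0"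
    "(\<lambda>n. \<integral>\<^sup>+ \<omega>. ennreal ((Y \<omega> - step_integral W (\<psi> n) \<omega>)\<^sup>2) \<partial>M) \<longlonglongrightarrow> 0"
    and [measurable]: "g \<in> borel_measurable borel" "Y \<in> borel_measurable M"
    by (auto simp: is_wiener_integral_def)
  have [measurable]: "step_integral W (\<phi> n) \<in> borel_measurable M" "step_integral W (\<psi> n) \<in> borel_measurable M" for n
    using step_integral_gaussian[OF sheet \<phi>(1)] step_integral_gaussian[OF sheet \<psi>(1)]
    by (auto simp: centred_gaussian_def)
  define a b A B where
    "a = (\<lambda>n. \<integral>\<^sup>+ p. ennreal ((f p - step_fun (\<phi> n) p)\<^sup>2) \<partial>lborel)" and
    "b = (\<lambda>n. \<integral>\<^sup>+ p. ennreal ((g p - step_fun (\<psi> n) p)\<^sup>2) \<partial>lborel)" and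
    "A = (\<lambda>n. \<integral>\<^sup>+ \<omega>. ennreal ((X \<omega> - step_integral W (\<phi> n) \<omega>)\<^sup>2) \<partial>M)" and
    "B = (\<lambda>n. \<integral>\<^sup>+ \<omega>. ennreal ((Y \<omega> - step_integral W (\<psi> n) \<omega>)\<^sup>2) \<partial>M)"
  define D where "D = (\<lambda>n. step_integral W (step_diff (\<phi> n) (\<psi> n)))"
  have Dval: "D n \<omega> = step_integral W (\<phi> n) \<omega> - step_integral W (\<psi> n) \<omega>" for n \<omega>
    by (simp add: D_def step_diff)
  have Dg: "centred_gaussian M (D n)" for n
    unfolding D_def by (intro step_integral_gaussian sheet step_diff \<phi> \<psi>)
  then have [measurable]: "D n \<in> borel_measurable M" for n by (simp add: centred_gaussian_def)
  have ab: "(\<lambda>n. 4 * a n + 4 * b n) \<longlonglongrightarrow> 4 * 0 + 4 * 0"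
    unfolding a_def b_def using \<phi>(2) \<psi>(2) by (intro tendsto_add ennreal_tendsto_cmult) auto
  then have ev: "eventually (\<lambda>n. 4 * a n + 4 * b n < ennreal v) sequentially"
    using \<open>v > 0\<close> by (intro order_tendstoD) auto
  have var: "(\<integral>\<omega>. (D n \<omega>)\<^sup>2 \<partial>M) \<le> 3 * v" if "4 * a n + 4 * b n < ennreal v" for n
  proof -
    have "ennreal (\<integral>\<omega>. (D n \<omega>)\<^sup>2 \<partial>M) = (\<integral>\<^sup>+ p. ennreal ((step_fun (\<phi> n) p - step_fun (\<psi> n) p)\<^sup>2) \<partial>lborel)"
      unfolding D_def using step_integral_isometry[OF \<open>prob_space M\<close> sheet step_diff(1)[OF \<phi>(1) \<psi>(1)], of n n]
      by (simp add: step_diff)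
    also have "\<dots> = (\<integral>\<^sup>+ p. ennreal ((- (f p - step_fun (\<phi> n) p) + (f p - g p) + (g p - step_fun (\<psi> n) p))\<^sup>2) \<partial>lborel)"
      by simp
    also have "\<dots> \<le> 2 * (\<integral>\<^sup>+ p. ennreal ((f p - g p)\<^sup>2) \<partial>lborel)
       + 4 * (\<integral>\<^sup>+ p. ennreal ((- (f p - step_fun (\<phi> n) p))\<^sup>2) \<partial>lborel) + 4 * b n"
      unfolding b_def by (intro nn_integral_square_sum3_le) auto
    also have "\<dots> = 2 * (\<integral>\<^sup>+ p. ennreal ((f p - g p)\<^sup>2) \<partial>lborel) + (4 * a n + 4 * b n)"
      unfolding a_def power2_minus by (simp add: add.assoc)
    also have "\<dots> \<le> 2 * ennreal v + ennreal v"
      using that dist by (intro add_mono mult_left_mono) auto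
    also have "\<dots> = ennreal (3 * v)"
      using \<open>v > 0\<close> by (simp add: ennreal_mult'' flip: ennreal_plus) (simp flip: ennreal_numeral ennreal_mult ennreal_plus)
    finally show ?thesis using \<open>v > 0\<close> by (simp add: ennreal_le_iff)
  qed
  have "(\<lambda>n. ennreal (sqrt 2 * exp (- l\<^sup>2 / (48 * v))) + ennreal (1 / (l/2)\<^sup>2) * (4 * A n + 4 * B n))
     \<longlonglongrightarrow> ennreal (sqrt 2 * exp (- l\<^sup>2 / (48 * v))) + ennreal (1 / (l/2)\<^sup>2) * (4 * 0 + 4 * 0)"
    unfolding A_def B_def using \<phi>(3) \<psi>(3)
    by (intro tendsto_add ennreal_tendsto_cmult tendsto_const) auto
  then have lim: "(\<lambda>n. ennreal (sqrt 2 * exp (- l\<^sup>2 / (48 * v))) + ennreal (1 / (l/2)\<^sup>2) * (4 * A n + 4 * B n))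
     \<longlonglongrightarrow> ennreal (sqrt 2 * exp (- l\<^sup>2 / (48 * v)))" by simp
  have "eventually (\<lambda>n. emeasure M {\<omega>\<in>space M. l \<le> \<bar>X \<omega> - Y \<omega>\<bar>}
      \<le> ennreal (sqrt 2 * exp (- l\<^sup>2 / (48 * v))) + ennreal (1 / (l/2)\<^sup>2) * (4 * A n + 4 * B n)) sequentially"
    using ev
  proof eventually_elim
    case (elim n)
    have "emeasure M {\<omega>\<in>space M. l \<le> \<bar>X \<omega> - Y \<omega>\<bar>}
       \<le> emeasure M ({\<omega>\<in>space M. l/2 \<le> \<bar>D n \<omega>\<bar>} \<union> {\<omega>\<in>space M. l/2 \<le> \<bar>X \<omega> - Y \<omega> - D n \<omega>\<bar>})"
      by (intro emeasure_mono) (auto, smt (verit) field_sum_of_halves)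
    also have "\<dots> \<le> emeasure M {\<omega>\<in>space M. l/2 \<le> \<bar>D n \<omega>\<bar>} + emeasure M {\<omega>\<in>space M. l/2 \<le> \<bar>X \<omega> - Y \<omega> - D n \<omega>\<bar>}"
      by (intro emeasure_subadditive) auto
    also have "\<dots> \<le> ennreal (sqrt 2 * exp (- l\<^sup>2 / (48 * v))) + ennreal (1 / (l/2)\<^sup>2) * (4 * A n + 4 * B n)"
    proof (rule add_mono)
      have "measure M {\<omega>\<in>space M. l/2 \<le> \<bar>D n \<omega>\<bar>} \<le> sqrt 2 * exp (- (l/2)\<^sup>2 / (4 * (3 * v)))"
        using \<open>v > 0\<close> \<open>l > 0\<close> by (intro centred_gaussian_tail[OF \<open>prob_space M\<close> Dg var[OF elim]]) auto
      also have "\<dots> = sqrt 2 * exp (- l\<^sup>2 / (48 * v))" by (simp add: power_divide)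
      finally show "emeasure M {\<omega>\<in>space M. l/2 \<le> \<bar>D n \<omega>\<bar>} \<le> ennreal (sqrt 2 * exp (- l\<^sup>2 / (48 * v)))"
        by (simp add: emeasure_eq_measure ennreal_leI)
      have "emeasure M {\<omega>\<in>space M. l/2 \<le> \<bar>X \<omega> - Y \<omega> - D n \<omega>\<bar>}
         \<le> ennreal (1 / (l/2)\<^sup>2) * (\<integral>\<^sup>+ \<omega>. ennreal ((X \<omega> - Y \<omega> - D n \<omega>)\<^sup>2) \<partial>M)"
        using \<open>l > 0\<close> by (intro second_moment_tail) auto
      also have "(\<integral>\<^sup>+ \<omega>. ennreal ((X \<omega> - Y \<omega> - D n \<omega>)\<^sup>2) \<partial>M)
         = (\<integral>\<^sup>+ \<omega>. ennreal (((X \<omega> - step_integral W (\<phi> n) \<omega>) + 0 + (- (Y \<omega> - step_integral W (\<psi> n) \<omega>)))\<^sup>2) \<partial>M)"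
        by (simp add: Dval algebra_simps)
      also have "\<dots> \<le> 2 * (\<integral>\<^sup>+ \<omega>. ennreal (0\<^sup>2) \<partial>M) + 4 * A n
          + 4 * (\<integral>\<^sup>+ \<omega>. ennreal ((- (Y \<omega> - step_integral W (\<psi> n) \<omega>))\<^sup>2) \<partial>M)"
        unfolding A_def by (intro nn_integral_square_sum3_le) auto
      also have "\<dots> = 4 * A n + 4 * B n"
        unfolding B_def power2_minus by simp
      finally show "emeasure M {\<omega>\<in>space M. l/2 \<le> \<bar>X \<omega> - Y \<omega> - D n \<omega>\<bar>}
         \<le> ennreal (1 / (l/2)\<^sup>2) * (4 * A n + 4 * B n)"
        by (simp add: mult_left_mono)
    qed
    finally show ?case .
  qed
  then have "emeasure M {\<omega>\<in>space M. l \<le> \<bar>X \<omega> - Y \<omega>\<bar>} \<le> ennreal (sqrt 2 * exp (- l\<^sup>2 / (48 * v)))"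
    by (intro tendsto_lowerbound[OF lim]) auto
  then show ?thesis by (simp add: emeasure_eq_measure)
qed

section \<open>The variance of the increments of the solution\<close>

text \<open>Differentiability is required in the interior only, because the integrands below are singular at
the right end point.\<close>

lemma nn_integral_FTC_interior:
  fixes F f :: "real \<Rightarrow> real"
  assumes "a \<le> b" and cont: "continuous_on {a..b} F"
    and deriv: "\<And>x. a < x \<Longrightarrow> x < b \<Longrightarrow> (F has_real_derivative f x) (at x)"
    and nonneg: "\<And>x. a < x \<Longrightarrow> x < b \<Longrightarrow> 0 \<le> f x"
  shows "(\<integral>\<^sup>+ x. ennreal (f x) * indicator {a..<b} x \<partial>lborel) = ennreal (F b - F a)"
proof -
  define g where "g = (\<lambda>x. if a < x \<and> x < b then f x else 0)"
  have "(g has_integral F b - F a) {a..b}"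
    using \<open>a \<le> b\<close> cont
  proof (rule fundamental_theorem_of_calculus_interior)
    fix x assume "x \<in> {a<..<b}"
    then show "(F has_vector_derivative g x) (at x)"
      using deriv[of x] by (simp add: g_def has_real_derivative_iff_has_vector_derivative)
  qed
  then have "integral\<^sup>N lborel (\<lambda>x. indicator {a..b} x * g x) = F b - F a"
    by (intro nn_integral_has_integral_lebesgue) (auto simp: g_def nonneg)
  moreover have "(\<integral>\<^sup>+ x. ennreal (f x) * indicator {a..<b} x \<partial>lborel)
    = integral\<^sup>N lborel (\<lambda>x. indicator {a..b} x * g x)"
    using AE_lborel_singleton[of a]
    by (intro nn_integral_cong_AE, elim eventually_mono) (auto simp: g_def indicator_def)
  ultimately show ?thesis by simp
qed

lemma nn_integral_inverse_sqrt:
  fixes a b :: real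
  assumes "a \<le> b"
  shows "(\<integral>\<^sup>+ r. ennreal (1 / sqrt (b - r)) * indicator {a..<b} r \<partial>lborel) = ennreal (2 * sqrt (b - a))"
proof -
  have "(\<integral>\<^sup>+ r. ennreal (1 / sqrt (b - r)) * indicator {a..<b} r \<partial>lborel)
     = ennreal ((\<lambda>r. - 2 * sqrt (b - r)) b - (\<lambda>r. - 2 * sqrt (b - r)) a)"
    using assms
    by (intro nn_integral_FTC_interior)
       (auto intro!: continuous_intros derivative_eq_intros simp: field_simps)
  then show ?thesis by simp
qed

text \<open>The bound does not depend on the length of the interval. This makes the variance of the increments
independent of the time horizon.\<close>

lemma nn_integral_inverse_sqrt_diff:
  fixes a b c :: real
  assumes "a \<le> b" "c \<ge> 0"
  shows "(\<integral>\<^sup>+ r. ennreal (1 / sqrt (b - r) - 1 / sqrt (b - r + c)) * indicator {a..<b} r \<partial>lborel)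
     \<le> ennreal (2 * sqrt c)"
proof -
  have "(\<integral>\<^sup>+ r. ennreal (1 / sqrt (b - r) - 1 / sqrt (b - r + c)) * indicator {a..<b} r \<partial>lborel)
     = ennreal ((\<lambda>r. 2 * sqrt (b - r + c) - 2 * sqrt (b - r)) b - (\<lambda>r. 2 * sqrt (b - r + c) - 2 * sqrt (b - r)) a)"
  proof (intro nn_integral_FTC_interior)
    fix x assume x: "a < x" "x < b"
    then have "0 < b - x" "0 < b - x + c" using assms by auto
    then show "((\<lambda>r. 2 * sqrt (b - r + c) - 2 * sqrt (b - r)) has_real_derivative
        1 / sqrt (b - x) - 1 / sqrt (b - x + c)) (at x)"
      by (auto intro!: derivative_eq_intros simp: field_simps)
    show "0 \<le> 1 / sqrt (b - x) - 1 / sqrt (b - x + c)"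
      using x assms by (simp add: frac_le)
  qed (auto intro!: continuous_intros assms)
  also have "\<dots> \<le> ennreal (2 * sqrt c)"
    using assms by (intro ennreal_leI) simp
  finally show ?thesis .
qed

lemma heat_kernel_normal_density: "t > 0 \<Longrightarrow> heat_kernel t y = normal_density 0 (sqrt t) y"
  by (simp add: heat_kernel_def normal_density_def)

lemma heat_kernel_nonneg: "heat_kernel t y \<ge> 0" if "t \<ge> 0"
  using that by (simp add: heat_kernel_def)

lemma heat_kernel_measurable [measurable]:
  "heat_kernel t \<in> borel_measurable borel"
  unfolding heat_kernel_def[abs_def] by measurable

text \<open>The semigroup property of the heat kernel, an instance of the convolution of normal densities. It
expresses \<open>L\<^sup>2\<close> distances of heat kernels by values of the kernel.\<close>

lemma heat_kernel_convolution:
  assumes "\<sigma> > 0" "\<tau> > 0"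
  shows "has_bochner_integral lborel (\<lambda>z. heat_kernel \<sigma> (y - z) * heat_kernel \<tau> (x - z)) (heat_kernel (\<sigma> + \<tau>) (y - x))"
proof -
  have nn: "(\<integral>\<^sup>+ z. ennreal (heat_kernel \<sigma> (y - z) * heat_kernel \<tau> (x - z)) \<partial>lborel)
      = ennreal (heat_kernel (\<sigma> + \<tau>) (y - x))"
  proof -
    have "(\<integral>\<^sup>+ z. ennreal (heat_kernel \<sigma> (y - z) * heat_kernel \<tau> (x - z)) \<partial>lborel)
      = (\<integral>\<^sup>+ z. ennreal (heat_kernel \<sigma> (y - x - z) * heat_kernel \<tau> z) \<partial>lborel)"
      by (subst nn_integral_real_affine[where c=1 and t=x])
         (auto simp: algebra_simps heat_kernel_def)
    also have "\<dots> = (\<integral>\<^sup>+ z. ennreal (normal_density 0 (sqrt \<sigma>) (y - x - z) * normal_density 0 (sqrt \<tau>) z) \<partial>lborel)"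
      using assms by (simp add: heat_kernel_normal_density)
    also have "\<dots> = ennreal (normal_density 0 (sqrt (\<sigma> + \<tau>)) (y - x))"
      using fun_cong[OF conv_normal_density_zero_mean[of "sqrt \<sigma>" "sqrt \<tau>"], of "y - x"] assms by simp
    finally show ?thesis using assms by (simp add: heat_kernel_normal_density)
  qed
  show ?thesis
    using assms
    by (intro has_bochner_integral_nn_integral nn) (auto intro!: AE_I2 mult_nonneg_nonneg heat_kernel_nonneg)
qed

lemma heat_kernel_L2_distance:
  assumes "\<sigma> > 0" "\<tau> > 0"
  shows "(\<integral>\<^sup>+ z. ennreal ((heat_kernel \<sigma> (y - z) - heat_kernel \<tau> (x - z))\<^sup>2) \<partial>lborel)
     = ennreal (heat_kernel (2 * \<sigma>) 0 + heat_kernel (2 * \<tau>) 0 - 2 * heat_kernel (\<sigma> + \<tau>) (y - x))"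
proof -
  have "has_bochner_integral lborel (\<lambda>z. heat_kernel \<sigma> (y - z) * heat_kernel \<sigma> (y - z)
      + heat_kernel \<tau> (x - z) * heat_kernel \<tau> (x - z) - 2 * (heat_kernel \<sigma> (y - z) * heat_kernel \<tau> (x - z)))
      (heat_kernel (\<sigma> + \<sigma>) (y - y) + heat_kernel (\<tau> + \<tau>) (x - x) - 2 * heat_kernel (\<sigma> + \<tau>) (y - x))"
    by (intro has_bochner_integral_add has_bochner_integral_diff has_bochner_integral_mult_right
        heat_kernel_convolution assms)
  then have *: "has_bochner_integral lborel (\<lambda>z. (heat_kernel \<sigma> (y - z) - heat_kernel \<tau> (x - z))\<^sup>2)
      (heat_kernel (2 * \<sigma>) 0 + heat_kernel (2 * \<tau>) 0 - 2 * heat_kernel (\<sigma> + \<tau>) (y - x))"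
    by (simp add: power2_eq_square algebra_simps)
  show ?thesis
    using nn_integral_eq_integral[OF integrable.intros[OF *]] * by (simp add: has_bochner_integral_iff)
qed

lemma heat_kernel_L2_norm:
  assumes "\<sigma> > 0"
  shows "(\<integral>\<^sup>+ z. ennreal ((heat_kernel \<sigma> (y - z))\<^sup>2) \<partial>lborel) = ennreal (heat_kernel (2 * \<sigma>) 0)"
  using heat_kernel_convolution[OF assms assms, of y y]
    nn_integral_eq_integral[OF integrable.intros[OF heat_kernel_convolution[OF assms assms, of y y]]]
    heat_kernel_nonneg[of \<sigma>] assms
  by (simp add: has_bochner_integral_iff power2_eq_square)

text \<open>With \<open>v = k\<^sup>2 / (4 * \<tau>)\<close> the right-hand side, divided by \<open>sqrt \<tau>\<close>, has an elementary antiderivative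
in \<open>\<tau>\<close>. Both sides behave like \<open>min 1 v\<close> up to constants, and the proof passes through
\<open>2 * v / (1 + v)\<close>.\<close>

lemma one_minus_exp_le:
  fixes v :: real assumes "v \<ge> 0"
  shows "1 - exp (- v) \<le> 4 * (1 - 1 / sqrt (1 + 4 * v))"
proof -
  have a: "1 - exp (- v) \<le> 2 * v / (1 + v)"
  proof (cases "v \<le> 1")
    case True
    have "1 - exp (- v) \<le> v" using exp_ge_add_one_self[of "- v"] by simp
    also have "v \<le> 2 * v / (1 + v)" using True assms mult_left_mono[of v 1 v] by (simp add: field_simps)
    finally show ?thesis .
  next
    case False
    then have "1 \<le> 2 * v / (1 + v)" by (simp add: field_simps)
    moreover have "1 - exp (- v) \<le> 1" by simp
    ultimately show ?thesis by linarith
  qed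
  have s: "sqrt (1 + 4 * v) \<ge> 1" "(sqrt (1 + 4 * v))\<^sup>2 = 1 + 4 * v" using assms by auto
  define q where "q = sqrt (1 + 4 * v)"
  have v: "v = (q\<^sup>2 - 1) / 4" and q: "q \<ge> 1" using s by (auto simp: q_def)
  have "2 * v / (1 + v) \<le> 4 * (1 - 1 / q)"
  proof -
    have "2 * v / (1 + v) = 2 * (q\<^sup>2 - 1) / (q\<^sup>2 + 3)"
    proof -
      have e: "1 + v = (q\<^sup>2 + 3) / 4" unfolding v by (simp add: field_simps)
      have "q\<^sup>2 + 3 \<noteq> 0" using zero_le_power2[of q] by linarith
      then show ?thesis unfolding e unfolding v by (simp add: field_simps)
    qed
    also have "\<dots> \<le> 4 * (1 - 1 / q)"
    proof -
      have "4 * (1 - 1 / q) - 2 * (q\<^sup>2 - 1) / (q\<^sup>2 + 3) = 2 * (q - 1) * (q\<^sup>2 - q + 6) / (q * (q\<^sup>2 + 3))"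
      proof -
        have "q \<noteq> 0" "q\<^sup>2 + 3 \<noteq> 0" using q by (auto simp: add_nonneg_eq_0_iff)
        then show ?thesis by (simp add: field_simps power2_eq_square)
      qed
      also have "\<dots> \<ge> 0"
      proof -
        have "q * 1 \<le> q * q" using q by (intro mult_left_mono) auto
        then have "q\<^sup>2 - q + 6 \<ge> 0" by (simp add: power2_eq_square)
        then show ?thesis using q by (intro divide_nonneg_nonneg mult_nonneg_nonneg) auto
      qed
      finally show ?thesis by simp
    qed
    finally show ?thesis .
  qed
  with a show ?thesis unfolding q_def by linarith
qed

lemma heat_kernel_at_0: "heat_kernel t 0 = 1 / sqrt (2 * pi) * (1 / sqrt t)"
  by (simp add: heat_kernel_def real_sqrt_mult)

text \<open>Here and in the next lemma the \<open>L\<^sup>2\<close> distance in space of two kernels is brought into the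
form \<open>1 / sqrt \<tau> - 1 / sqrt (\<tau> + c)\<close>, whose integral over \<open>\<tau>\<close> is at most \<open>2 * sqrt c\<close>.\<close>

lemma heat_kernel_space_increment:
  assumes "\<tau> > 0"
  shows "2 * heat_kernel (2 * \<tau>) 0 - 2 * heat_kernel (2 * \<tau>) k \<le> 4 * (1 / sqrt \<tau> - 1 / sqrt (\<tau> + k\<^sup>2))"
proof -
  define v where "v = k\<^sup>2 / (4 * \<tau>)"
  have v: "v \<ge> 0" using assms by (simp add: v_def)
  have "2 * heat_kernel (2 * \<tau>) 0 - 2 * heat_kernel (2 * \<tau>) k = 2 / sqrt (2 * pi * (2 * \<tau>)) * (1 - exp (- v))"
    using assms by (simp add: heat_kernel_def v_def algebra_simps)
  also have "\<dots> = 1 / sqrt pi * (1 / sqrt \<tau>) * (1 - exp (- v))"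
  proof -
    have "sqrt (2 * pi * (2 * \<tau>)) = sqrt (2\<^sup>2 * (pi * \<tau>))" by (simp add: algebra_simps)
    also have "\<dots> = 2 * (sqrt pi * sqrt \<tau>)" by (simp add: real_sqrt_mult)
    finally show ?thesis by simp
  qed
  also have "\<dots> \<le> 1 * (1 / sqrt \<tau>) * (4 * (1 - 1 / sqrt (1 + 4 * v)))"
  proof (intro mult_mono one_minus_exp_le)
    have "1 \<le> sqrt pi" using pi_gt3 by simp
    then show "1 / sqrt pi \<le> 1" by simp
  qed (use v assms in auto)
  also have "\<dots> = 4 * (1 / sqrt \<tau> - 1 / sqrt (\<tau> + k\<^sup>2))"
  proof -
    have "\<tau> + k\<^sup>2 = \<tau> * (1 + 4 * v)" using assms by (simp add: v_def field_simps)
    then have "sqrt (\<tau> + k\<^sup>2) = sqrt \<tau> * sqrt (1 + 4 * v)" by (simp only: real_sqrt_mult)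
    then show ?thesis by (simp add: right_diff_distrib)
  qed
  finally show ?thesis .
qed

lemma heat_kernel_time_increment:
  assumes "\<tau> > 0" "h \<ge> 0"
  shows "heat_kernel (2 * (\<tau> + h)) 0 + heat_kernel (2 * \<tau>) 0 - 2 * heat_kernel (\<tau> + h + \<tau>) 0
     \<le> 1 / sqrt \<tau> - 1 / sqrt (\<tau> + h / 2)"
proof -
  have "heat_kernel (2 * (\<tau> + h)) 0 + heat_kernel (2 * \<tau>) 0 - 2 * heat_kernel (\<tau> + h + \<tau>) 0
     = 1 / sqrt (2 * pi) * (1 / sqrt (2 * (\<tau> + h)) + 1 / sqrt (2 * \<tau>) - 2 * (1 / sqrt (2 * \<tau> + h)))"
    unfolding heat_kernel_at_0 by (simp add: algebra_simps)
  also have "\<dots> \<le> 1 / sqrt (2 * pi) * (1 / sqrt (2 * \<tau>) - 1 / sqrt (2 * \<tau> + h))"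
  proof (rule mult_left_mono)
    have "1 / sqrt (2 * (\<tau> + h)) \<le> 1 / sqrt (2 * \<tau> + h)"
      using assms by (intro divide_left_mono) auto
    then show "1 / sqrt (2 * (\<tau> + h)) + 1 / sqrt (2 * \<tau>) - 2 * (1 / sqrt (2 * \<tau> + h))
       \<le> 1 / sqrt (2 * \<tau>) - 1 / sqrt (2 * \<tau> + h)" by simp
  qed simp
  also have "\<dots> = 1 / (sqrt (2 * pi) * sqrt 2) * (1 / sqrt \<tau> - 1 / sqrt (\<tau> + h / 2))"
  proof -
    have "2 * \<tau> + h = 2 * (\<tau> + h / 2)" by simp
    then have "sqrt (2 * \<tau> + h) = sqrt 2 * sqrt (\<tau> + h / 2)" by (simp only: real_sqrt_mult)
    then show ?thesis by (simp add: real_sqrt_mult diff_divide_distrib right_diff_distrib)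
  qed
  also have "\<dots> \<le> 1 * (1 / sqrt \<tau> - 1 / sqrt (\<tau> + h / 2))"
  proof (rule mult_right_mono)
    have "1 \<le> sqrt (2 * pi) * sqrt 2" using pi_gt3 by (simp flip: real_sqrt_mult)
    then show "1 / (sqrt (2 * pi) * sqrt 2) \<le> 1" by simp
    show "0 \<le> 1 / sqrt \<tau> - 1 / sqrt (\<tau> + h / 2)" using assms by (simp add: frac_le)
  qed
  finally show ?thesis by simp
qed

definition heat_integrand :: "real \<Rightarrow> real \<Rightarrow> real \<times> real \<Rightarrow> real" where
  "heat_integrand t y = (\<lambda>(r, z). if 0 \<le> r \<and> r < t then heat_kernel (t - r) (y - z) else 0)"

lemma heat_integrand_measurable [measurable]: "heat_integrand t y \<in> borel_measurable borel"
proof -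
  have "(\<lambda>(r, z). if 0 \<le> r \<and> r < t then heat_kernel (t - r) (y - z) else 0) \<in> borel_measurable (borel \<Otimes>\<^sub>M borel)"
    unfolding heat_kernel_def case_prod_unfold by measurable
  then show ?thesis unfolding heat_integrand_def borel_prod .
qed

lemma nn_integral_heat_integrand_diff:
  "(\<integral>\<^sup>+ p. ennreal ((heat_integrand t y p - heat_integrand s x p)\<^sup>2) \<partial>lborel)
   = (\<integral>\<^sup>+ r. \<integral>\<^sup>+ z. ennreal ((heat_integrand t y (r, z) - heat_integrand s x (r, z))\<^sup>2) \<partial>lborel \<partial>lborel)"
proof -
  have "(\<lambda>p. ennreal ((heat_integrand t y p - heat_integrand s x p)\<^sup>2)) \<in> borel_measurable (lborel \<Otimes>\<^sub>M lborel)"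
    unfolding lborel_prod by measurable
  from lborel.nn_integral_fst[OF this] show ?thesis by (simp add: lborel_prod)
qed

lemma heat_integrand_space_increment:
  assumes "t \<ge> 0"
  shows "(\<integral>\<^sup>+ p. ennreal ((heat_integrand t y p - heat_integrand t x p)\<^sup>2) \<partial>lborel) \<le> ennreal (8 * \<bar>x - y\<bar>)"
proof -
  have "(\<integral>\<^sup>+ z. ennreal ((heat_integrand t y (r, z) - heat_integrand t x (r, z))\<^sup>2) \<partial>lborel)
     \<le> ennreal 4 * (ennreal (1 / sqrt (t - r) - 1 / sqrt (t - r + (y - x)\<^sup>2)) * indicator {0..<t} r)" for r
  proof (cases "0 \<le> r \<and> r < t")
    case True
    then have "(\<integral>\<^sup>+ z. ennreal ((heat_integrand t y (r, z) - heat_integrand t x (r, z))\<^sup>2) \<partial>lborel)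
      = ennreal (2 * heat_kernel (2 * (t - r)) 0 - 2 * heat_kernel (2 * (t - r)) (y - x))"
      using heat_kernel_L2_distance[of "t - r" "t - r" y x] by (simp add: heat_integrand_def)
    also have "\<dots> \<le> ennreal (4 * (1 / sqrt (t - r) - 1 / sqrt (t - r + (y - x)\<^sup>2)))"
      using True by (intro ennreal_leI heat_kernel_space_increment) auto
    also have "\<dots> = ennreal 4 * ennreal (1 / sqrt (t - r) - 1 / sqrt (t - r + (y - x)\<^sup>2))"
      by (rule ennreal_mult') simp
    finally show ?thesis using True by simp
  qed (auto simp: heat_integrand_def)
  then have "(\<integral>\<^sup>+ p. ennreal ((heat_integrand t y p - heat_integrand t x p)\<^sup>2) \<partial>lborel)
    \<le> (\<integral>\<^sup>+ r. ennreal 4 * (ennreal (1 / sqrt (t - r) - 1 / sqrt (t - r + (y - x)\<^sup>2)) * indicator {0..<t} r) \<partial>lborel)"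
    unfolding nn_integral_heat_integrand_diff by (intro nn_integral_mono)
  also have "\<dots> = ennreal 4 * (\<integral>\<^sup>+ r. ennreal (1 / sqrt (t - r) - 1 / sqrt (t - r + (y - x)\<^sup>2)) * indicator {0..<t} r \<partial>lborel)"
    by (intro nn_integral_cmult) measurable
  also have "\<dots> \<le> ennreal 4 * ennreal (2 * sqrt ((y - x)\<^sup>2))"
    using assms by (intro mult_left_mono nn_integral_inverse_sqrt_diff) auto
  also have "\<dots> = ennreal (8 * \<bar>x - y\<bar>)"
    by (simp add: ennreal_mult''[symmetric] abs_minus_commute del: ennreal_numeral)
  finally show ?thesis .
qed

text \<open>Before time \<open>s\<close> both kernels are present and their difference is small by regularity of the heat
kernel; between \<open>s\<close> and \<open>t\<close> only the later one is, and its own norm is small.\<close>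

lemma heat_integrand_time_increment:
  assumes "0 \<le> s" "s \<le> t"
  shows "(\<integral>\<^sup>+ p. ennreal ((heat_integrand t y p - heat_integrand s y p)\<^sup>2) \<partial>lborel) \<le> ennreal (4 * sqrt (t - s))"
proof -
  define h where "h = t - s"
  have h: "h \<ge> 0" "t = s + h" using assms by (auto simp: h_def)
  have "(\<integral>\<^sup>+ z. ennreal ((heat_integrand t y (r, z) - heat_integrand s y (r, z))\<^sup>2) \<partial>lborel)
     \<le> ennreal (1 / sqrt (s - r) - 1 / sqrt (s - r + h / 2)) * indicator {0..<s} r
       + ennreal (1 / sqrt (t - r)) * indicator {s..<t} r" for r
  proof -
    consider "0 \<le> r" "r < s" | "s \<le> r" "r < t" | "r < 0 \<or> t \<le> r" by linarith
    then show ?thesis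
    proof cases
      case 1
      then have "(\<integral>\<^sup>+ z. ennreal ((heat_integrand t y (r, z) - heat_integrand s y (r, z))\<^sup>2) \<partial>lborel)
        = ennreal (heat_kernel (2 * (s - r + h)) 0 + heat_kernel (2 * (s - r)) 0 - 2 * heat_kernel (s - r + h + (s - r)) 0)"
        using heat_kernel_L2_distance[of "s - r + h" "s - r" y y] h
        by (simp add: heat_integrand_def algebra_simps)
      also have "\<dots> \<le> ennreal (1 / sqrt (s - r) - 1 / sqrt (s - r + h / 2))"
        using 1 h by (intro ennreal_leI heat_kernel_time_increment) auto
      finally show ?thesis using 1 by simp
    next
      case 2
      then have "(\<integral>\<^sup>+ z. ennreal ((heat_integrand t y (r, z) - heat_integrand s y (r, z))\<^sup>2) \<partial>lborel)
        = ennreal (heat_kernel (2 * (t - r)) 0)"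
        using heat_kernel_L2_norm[of "t - r" y] assms by (simp add: heat_integrand_def)
      also have "\<dots> \<le> ennreal (1 / sqrt (t - r))"
      proof (rule ennreal_leI)
        have "1 \<le> sqrt (2 * pi) * sqrt 2" using pi_gt3 by (simp flip: real_sqrt_mult)
        then have "1 / (sqrt (2 * pi) * sqrt 2) * (1 / sqrt (t - r)) \<le> 1 * (1 / sqrt (t - r))"
          using 2 by (intro mult_right_mono) auto
        then show "heat_kernel (2 * (t - r)) 0 \<le> 1 / sqrt (t - r)"
          unfolding heat_kernel_at_0 real_sqrt_mult[of 2 "t - r"] by (simp add: mult.assoc)
      qed
      finally show ?thesis using 2 by simp
    next
      case 3
      then show ?thesis using assms by (auto simp: heat_integrand_def)
    qed
  qed
  then have "(\<integral>\<^sup>+ p. ennreal ((heat_integrand t y p - heat_integrand s y p)\<^sup>2) \<partial>lborel)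
    \<le> (\<integral>\<^sup>+ r. ennreal (1 / sqrt (s - r) - 1 / sqrt (s - r + h / 2)) * indicator {0..<s} r
       + ennreal (1 / sqrt (t - r)) * indicator {s..<t} r \<partial>lborel)"
    unfolding nn_integral_heat_integrand_diff by (intro nn_integral_mono)
  also have "\<dots> = (\<integral>\<^sup>+ r. ennreal (1 / sqrt (s - r) - 1 / sqrt (s - r + h / 2)) * indicator {0..<s} r \<partial>lborel)
       + (\<integral>\<^sup>+ r. ennreal (1 / sqrt (t - r)) * indicator {s..<t} r \<partial>lborel)"
    by (intro nn_integral_add) measurable
  also have "\<dots> \<le> ennreal (2 * sqrt (h / 2)) + ennreal (2 * sqrt (t - s))"
    using assms h by (intro add_mono nn_integral_inverse_sqrt_diff) (auto simp: nn_integral_inverse_sqrt)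
  also have "\<dots> = ennreal (2 * sqrt (h / 2) + 2 * sqrt (t - s))"
    using assms h by (intro ennreal_plus[symmetric]) auto
  also have "\<dots> \<le> ennreal (4 * sqrt (t - s))"
  proof (rule ennreal_leI)
    have "sqrt (h / 2) \<le> sqrt h" using h by simp
    then show "2 * sqrt (h / 2) + 2 * sqrt (t - s) \<le> 4 * sqrt (t - s)" by (simp add: h_def)
  qed
  finally show ?thesis .
qed

text \<open>The path from \<open>(s, x)\<close> to \<open>(t, y)\<close> goes through \<open>(t, x)\<close>. Squaring the sum of the two steps doubles
both bounds.\<close>

lemma heat_integrand_increment:
  assumes "0 \<le> s" "0 \<le> t"
  shows "(\<integral>\<^sup>+ p. ennreal ((heat_integrand t y p - heat_integrand s x p)\<^sup>2) \<partial>lborel)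
     \<le> ennreal (16 * (sqrt \<bar>t - s\<bar> + \<bar>x - y\<bar>))"
proof -
  have time: "(\<integral>\<^sup>+ p. ennreal ((heat_integrand t x p - heat_integrand s x p)\<^sup>2) \<partial>lborel) \<le> ennreal (4 * sqrt \<bar>t - s\<bar>)"
  proof (cases "s \<le> t")
    case True
    then show ?thesis using heat_integrand_time_increment[of s t x] assms by simp
  next
    case False
    then show ?thesis using heat_integrand_time_increment[of t s x] assms by (simp add: power2_commute)
  qed
  have "(\<integral>\<^sup>+ p. ennreal ((heat_integrand t y p - heat_integrand s x p)\<^sup>2) \<partial>lborel)
    \<le> (\<integral>\<^sup>+ p. 2 * ennreal ((heat_integrand t y p - heat_integrand t x p)\<^sup>2)
        + 2 * ennreal ((heat_integrand t x p - heat_integrand s x p)\<^sup>2) \<partial>lborel)"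
  proof (rule nn_integral_mono)
    fix p
    have sq: "(a - c)\<^sup>2 \<le> 2 * (a - b)\<^sup>2 + 2 * (b - c)\<^sup>2" for a b c :: real
    proof -
      have "2 * (a - b)\<^sup>2 + 2 * (b - c)\<^sup>2 - (a - c)\<^sup>2 = (a - 2 * b + c)\<^sup>2"
        by (simp add: power2_eq_square algebra_simps)
      moreover have "0 \<le> (a - 2 * b + c)\<^sup>2" by simp
      ultimately show ?thesis by linarith
    qed
    show "ennreal ((heat_integrand t y p - heat_integrand s x p)\<^sup>2)
      \<le> 2 * ennreal ((heat_integrand t y p - heat_integrand t x p)\<^sup>2)
        + 2 * ennreal ((heat_integrand t x p - heat_integrand s x p)\<^sup>2)"
      using ennreal_leI[OF sq[of "heat_integrand t y p" "heat_integrand s x p" "heat_integrand t x p"]]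
      by (simp add: ennreal_mult'' ennreal_plus)
  qed
  also have "\<dots> = 2 * (\<integral>\<^sup>+ p. ennreal ((heat_integrand t y p - heat_integrand t x p)\<^sup>2) \<partial>lborel)
      + 2 * (\<integral>\<^sup>+ p. ennreal ((heat_integrand t x p - heat_integrand s x p)\<^sup>2) \<partial>lborel)"
    by (simp add: nn_integral_add nn_integral_cmult)
  also have "\<dots> \<le> 2 * ennreal (8 * \<bar>x - y\<bar>) + 2 * ennreal (4 * sqrt \<bar>t - s\<bar>)"
    using assms by (intro add_mono mult_left_mono heat_integrand_space_increment time) auto
  also have "\<dots> = ennreal (16 * \<bar>x - y\<bar> + 8 * sqrt \<bar>t - s\<bar>)"
    by (subst ennreal_plus) (auto simp: ennreal_mult'' simp flip: mult.assoc)
  also have "\<dots> \<le> ennreal (16 * (sqrt \<bar>t - s\<bar> + \<bar>x - y\<bar>))"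
    by (intro ennreal_leI) simp
  finally show ?thesis .
qed

section \<open>Chaining along parabolic grids\<close>

text \<open>The expected order of the increments of the solution across one cell of the grid of level \<open>n\<close>: the
variance is of order \<open>2 powr - n\<close>, and the maximum over a number of grid points exponential in \<open>n\<close>
contributes the factor \<open>n + 1\<close>.\<close>

definition chain_weight :: "nat \<Rightarrow> real" where
  "chain_weight n = sqrt (real (n + 1) / 2 ^ n)"

lemma chain_weight_nonneg [simp]: "0 \<le> chain_weight n"
  by (simp add: chain_weight_def)

text \<open>Submultiplicativity bounds the sum of all weights from level \<open>n\<close> on by a constant times the
weight of level \<open>n\<close>.\<close>

lemma chain_weight_add_le: "chain_weight (m + n) \<le> chain_weight m * chain_weight n"
proof -
  have "real (m + n + 1) / 2 ^ (m + n) \<le> (real (m + 1) / 2 ^ m) * (real (n + 1) / 2 ^ n)"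
    by (simp add: power_add divide_right_mono algebra_simps)
  then show ?thesis unfolding chain_weight_def real_sqrt_mult[symmetric] by (rule real_sqrt_le_mono)
qed

lemma chain_weight_Suc_le: "chain_weight (Suc n) \<le> chain_weight n"
  unfolding chain_weight_def by (intro real_sqrt_le_mono) (simp add: field_simps)

lemma summable_chain_weight: "summable chain_weight"
proof (rule summable_comparison_test')
  show "summable (\<lambda>n. sqrt 2 * sqrt (3/4) ^ n)"
    by (intro summable_mult summable_geometric) simp
  fix n :: nat
  have "1 + real n * (1/2) \<le> (1 + 1/2) ^ n" by (rule Bernoulli_inequality) simp
  then have "real (n + 1) \<le> 2 * (3/2) ^ n" by simp
  then have "real (n + 1) / 2 ^ n \<le> 2 * (3/2) ^ n / 2 ^ n" by (rule divide_right_mono) simp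
  also have "\<dots> = 2 * (3/4) ^ n" using power_divide[of "3/2::real" 2 n] by simp
  finally have "chain_weight n \<le> sqrt (2 * (3/4) ^ n)"
    unfolding chain_weight_def by (rule real_sqrt_le_mono)
  then show "norm (chain_weight n) \<le> sqrt 2 * sqrt (3/4) ^ n"
    by (simp only: real_sqrt_mult real_sqrt_power real_norm_def abs_of_nonneg[OF chain_weight_nonneg])
qed

text \<open>The indices of the points \<open>(i / 4 ^ n, j / 2 ^ n)\<close> of a parabolic grid. The grid extends one unit to the
left of \<open>a\<close>, so that it contains the points of \<open>[a, b]\<close> rounded down at its own level and
also those rounded down at the preceding level.\<close>

definition grid :: "real \<Rightarrow> real \<Rightarrow> real \<Rightarrow> nat \<Rightarrow> (int \<times> int) set" where
  "grid T a b n = {0..\<lfloor>T * 4 ^ n\<rfloor>} \<times> {\<lceil>(a - 1) * 2 ^ n\<rceil>..\<lfloor>b * 2 ^ n\<rfloor>}"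

definition grid_value :: "(real \<Rightarrow> real \<Rightarrow> real) \<Rightarrow> nat \<Rightarrow> int \<times> int \<Rightarrow> real" where
  "grid_value v n p = v (of_int (fst p) / 4 ^ n) (of_int (snd p) / 2 ^ n)"

text \<open>Rounding down at level \<open>n\<close> and at level \<open>n + 1\<close> gives points whose indices at level \<open>n + 1\<close> differ by
at most \<open>3\<close> in time and \<open>1\<close> in space. The tolerance covers this and also neighbours of one level.\<close>

definition grid_link :: "int \<times> int \<Rightarrow> int \<times> int \<Rightarrow> bool" where
  "grid_link p q \<longleftrightarrow> \<bar>fst p - fst q\<bar> \<le> 4 \<and> \<bar>snd p - snd q\<bar> \<le> 2"

definition grid_floor :: "nat \<Rightarrow> real \<Rightarrow> real \<Rightarrow> int \<times> int" where
  "grid_floor n t y = (\<lfloor>t * 4 ^ n\<rfloor>, \<lfloor>y * 2 ^ n\<rfloor>)"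

lemma grid_floor_in_grid:
  assumes "t \<in> {0..T}" "y \<in> {a..b}"
  shows "grid_floor n t y \<in> grid T a b n"
proof -
  have "(a - 1) * 2 ^ n \<le> of_int \<lfloor>y * 2 ^ n\<rfloor>"
  proof -
    have "(a - 1) * 2 ^ n \<le> (y - 1) * 2 ^ n" using assms by (intro mult_right_mono) auto
    also have "\<dots> \<le> y * 2 ^ n - 1" by (simp add: algebra_simps)
    also have "\<dots> \<le> of_int \<lfloor>y * 2 ^ n\<rfloor>" by linarith
    finally show ?thesis .
  qed
  moreover have "\<lfloor>y * 2 ^ n\<rfloor> \<le> \<lfloor>b * 2 ^ n\<rfloor>" "\<lfloor>t * 4 ^ n\<rfloor> \<le> \<lfloor>T * 4 ^ n\<rfloor>"
    using assms by (auto intro!: floor_mono mult_right_mono)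
  ultimately show ?thesis using assms by (simp add: grid_floor_def grid_def ceiling_le_iff)
qed

lemma refined_grid_floor_in_grid:
  assumes "t \<in> {0..T}" "y \<in> {a..b}"
  shows "(4 * \<lfloor>t * 4 ^ n\<rfloor>, 2 * \<lfloor>y * 2 ^ n\<rfloor>) \<in> grid T a b (Suc n)"
proof -
  have "(a - 1) * 2 ^ Suc n \<le> of_int (2 * \<lfloor>y * 2 ^ n\<rfloor>)"
  proof -
    have "(a - 1) * 2 ^ Suc n \<le> (y - 1) * 2 ^ Suc n" using assms by (intro mult_right_mono) auto
    also have "\<dots> \<le> 2 * (y * 2 ^ n - 1)" by (simp add: algebra_simps)
    also have "\<dots> \<le> of_int (2 * \<lfloor>y * 2 ^ n\<rfloor>)" by simp linarith
    finally show ?thesis .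
  qed
  moreover have "of_int (2 * \<lfloor>y * 2 ^ n\<rfloor>) \<le> b * 2 ^ Suc n"
  proof -
    have "real_of_int (2 * \<lfloor>y * 2 ^ n\<rfloor>) \<le> 2 * (y * 2 ^ n)" by simp
    also have "\<dots> \<le> b * 2 ^ Suc n" using assms by simp
    finally show ?thesis .
  qed
  moreover have "of_int (4 * \<lfloor>t * 4 ^ n\<rfloor>) \<le> T * 4 ^ Suc n"
  proof -
    have "real_of_int (4 * \<lfloor>t * 4 ^ n\<rfloor>) \<le> 4 * (t * 4 ^ n)" by simp
    also have "\<dots> \<le> T * 4 ^ Suc n" using assms by simp
    finally show ?thesis .
  qed
  ultimately show ?thesis using assms by (simp add: grid_def ceiling_le_iff le_floor_iff)
qed

lemma grid_floor_link:
  assumes "\<bar>t - s\<bar> * 4 ^ n \<le> 1" "\<bar>y - x\<bar> * 2 ^ n \<le> 1"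
  shows "grid_link (grid_floor n t y) (grid_floor n s x)"
proof -
  have fl: "\<bar>\<lfloor>p\<rfloor> - \<lfloor>q\<rfloor>\<bar> \<le> 1" if "\<bar>p - q\<bar> \<le> 1" for p q :: real
    using that by linarith
  have "\<bar>t * 4 ^ n - s * 4 ^ n\<bar> \<le> 1" "\<bar>y * 2 ^ n - x * 2 ^ n\<bar> \<le> 1"
    using assms by (simp_all add: abs_mult flip: left_diff_distrib)
  from fl[OF this(1)] fl[OF this(2)] show ?thesis by (simp add: grid_link_def grid_floor_def)
qed

lemma refined_grid_floor_link:
  "grid_link (4 * \<lfloor>t * 4 ^ n\<rfloor>, 2 * \<lfloor>y * 2 ^ n\<rfloor>) (grid_floor (Suc n) t y)"
proof -
  have "\<bar>4 * \<lfloor>p\<rfloor> - \<lfloor>4 * p\<rfloor>\<bar> \<le> 4" "\<bar>2 * \<lfloor>q\<rfloor> - \<lfloor>2 * q\<rfloor>\<bar> \<le> 2" for p q :: real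
    by linarith+
  from this(1)[of "t * 4 ^ n"] this(2)[of "y * 2 ^ n"] show ?thesis
    by (simp add: grid_link_def grid_floor_def algebra_simps)
qed

lemma floor_scaled_tendsto:
  fixes c y :: real assumes "c > 1"
  shows "(\<lambda>m. of_int \<lfloor>y * c ^ m\<rfloor> / c ^ m) \<longlonglongrightarrow> y"
proof (rule real_tendsto_sandwich)
  have "(\<lambda>m. y - inverse c ^ m) \<longlonglongrightarrow> y - 0"
    using assms by (intro tendsto_diff tendsto_const LIMSEQ_realpow_zero) (auto simp: field_simps)
  then show "(\<lambda>m. y - inverse c ^ m) \<longlonglongrightarrow> y" by simp
  have pos: "c ^ m > 0" for m using assms by simp
  have "y - inverse c ^ m \<le> of_int \<lfloor>y * c ^ m\<rfloor> / c ^ m" for m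
  proof -
    have "y - inverse c ^ m = (y * c ^ m - 1) / c ^ m"
      using assms by (simp add: field_simps)
    also have "\<dots> \<le> of_int \<lfloor>y * c ^ m\<rfloor> / c ^ m"
      using pos[of m] by (intro divide_right_mono) (linarith, simp)
    finally show ?thesis .
  qed
  then show "eventually (\<lambda>m. y - inverse c ^ m \<le> of_int \<lfloor>y * c ^ m\<rfloor> / c ^ m) sequentially" by simp
  have "of_int \<lfloor>y * c ^ m\<rfloor> / c ^ m \<le> y" for m
    using pos[of m] by (simp add: pos_divide_le_eq)
  then show "eventually (\<lambda>m. of_int \<lfloor>y * c ^ m\<rfloor> / c ^ m \<le> y) sequentially" by simp
qed simp

lemma grid_value_tendsto:
  assumes cont: "continuous_on ({0..T} \<times> UNIV) (\<lambda>(t, y). v t y)" and t: "t \<in> {0..T}"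
  shows "(\<lambda>m. grid_value v m (grid_floor m t y)) \<longlonglongrightarrow> v t y"
proof -
  let ?p = "\<lambda>m. (of_int \<lfloor>t * 4 ^ m\<rfloor> / 4 ^ m, of_int \<lfloor>y * 2 ^ m\<rfloor> / 2 ^ m) :: real \<times> real"
  have "?p \<longlonglongrightarrow> (t, y)" by (intro tendsto_Pair floor_scaled_tendsto) auto
  moreover have "?p m \<in> {0..T} \<times> UNIV" for m
  proof -
    have "of_int \<lfloor>t * 4 ^ m\<rfloor> / 4 ^ m \<le> t" by (simp add: pos_divide_le_eq)
    then show ?thesis using t by auto
  qed
  ultimately have "(\<lambda>m. (\<lambda>(t, y). v t y) (?p m)) \<longlonglongrightarrow> (\<lambda>(t, y). v t y) (t, y)"
    using t by (intro continuous_on_tendsto_compose[OF cont]) auto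
  then show ?thesis by (simp add: grid_value_def grid_floor_def)
qed

text \<open>Each point is the limit of its roundings at the levels \<open>n, n + 1, \<dots>\<close>, and consecutive roundings are
linked in the finer grid. Summing the links bounds the distance of \<open>v\<close> at a point from its value at
the rounding of level \<open>n\<close> by a multiple of \<open>chain_weight n\<close>. The roundings of level \<open>n\<close> of
the two given points are linked as well.\<close>

lemma chaining:
  assumes cont: "continuous_on ({0..T} \<times> UNIV) (\<lambda>(t, y). v t y)"
    and links: "\<And>n p q. N \<le> n \<Longrightarrow> p \<in> grid T a b n \<Longrightarrow> q \<in> grid T a b n \<Longrightarrow> grid_link p q \<Longrightarrow>
        \<bar>grid_value v n p - grid_value v n q\<bar> \<le> K * chain_weight n"
    and "K \<ge> 0" "N \<le> n" and t: "t \<in> {0..T}" and s: "s \<in> {0..T}" and y: "y \<in> {a..b}" and x: "x \<in> {a..b}"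
    and close: "\<bar>t - s\<bar> * 4 ^ n \<le> 1" "\<bar>y - x\<bar> * 2 ^ n \<le> 1"
  shows "\<bar>v t y - v s x\<bar> \<le> K * (1 + 2 * suminf chain_weight) * chain_weight n"
proof -
  define S where "S = suminf chain_weight"
  have tail: "\<bar>grid_value v n (grid_floor n t y) - v t y\<bar> \<le> K * (chain_weight n * S)"
    if t: "t \<in> {0..T}" and y: "y \<in> {a..b}" for t y
  proof -
    let ?g = "\<lambda>m. grid_value v m (grid_floor m t y)"
    have step: "\<bar>?g m - ?g (Suc m)\<bar> \<le> K * chain_weight m" if "N \<le> m" for m
    proof -
      let ?r = "(4 * \<lfloor>t * 4 ^ m\<rfloor>, 2 * \<lfloor>y * 2 ^ m\<rfloor>)"
      have "?g m = grid_value v (Suc m) ?r"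
        by (simp add: grid_value_def grid_floor_def)
      moreover have "\<bar>grid_value v (Suc m) ?r - ?g (Suc m)\<bar> \<le> K * chain_weight (Suc m)"
        using that t y
        by (intro links refined_grid_floor_in_grid grid_floor_in_grid refined_grid_floor_link) auto
      moreover have "K * chain_weight (Suc m) \<le> K * chain_weight m"
        using \<open>K \<ge> 0\<close> by (intro mult_left_mono chain_weight_Suc_le)
      ultimately show ?thesis by simp
    qed
    have partial: "\<bar>?g n - ?g (n + M)\<bar> \<le> K * (\<Sum>j<M. chain_weight (n + j))" for M
    proof (induction M)
      case (Suc M)
      have "\<bar>?g n - ?g (n + Suc M)\<bar> \<le> \<bar>?g n - ?g (n + M)\<bar> + \<bar>?g (n + M) - ?g (Suc (n + M))\<bar>"
        by simp
      also have "\<dots> \<le> K * (\<Sum>j<M. chain_weight (n + j)) + K * chain_weight (n + M)"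
        using \<open>N \<le> n\<close> by (intro add_mono Suc.IH step) auto
      finally show ?case by (simp add: algebra_simps)
    qed simp
    have bound: "\<bar>?g n - ?g (n + M)\<bar> \<le> K * (chain_weight n * S)" for M
    proof -
      have "(\<Sum>j<M. chain_weight (n + j)) \<le> (\<Sum>j<M. chain_weight n * chain_weight j)"
        by (intro sum_mono chain_weight_add_le)
      also have "\<dots> = chain_weight n * (\<Sum>j<M. chain_weight j)"
        by (simp add: sum_distrib_left)
      also have "\<dots> \<le> chain_weight n * S"
        unfolding S_def by (intro mult_left_mono sum_le_suminf summable_chain_weight) auto
      finally have "K * (\<Sum>j<M. chain_weight (n + j)) \<le> K * (chain_weight n * S)"
        using \<open>K \<ge> 0\<close> by (rule mult_left_mono)
      with partial[of M] show ?thesis by linarith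
    qed
    have "(\<lambda>M. \<bar>?g n - ?g (M + n)\<bar>) \<longlonglongrightarrow> \<bar>?g n - v t y\<bar>"
      using LIMSEQ_ignore_initial_segment[OF grid_value_tendsto[OF cont t, of y], of n]
      by (intro tendsto_intros)
    then show ?thesis
      using bound by (intro LIMSEQ_le_const2) (auto simp: add.commute)
  qed
  have "\<bar>grid_value v n (grid_floor n t y) - grid_value v n (grid_floor n s x)\<bar> \<le> K * chain_weight n"
    using t s y x close \<open>N \<le> n\<close> by (intro links grid_floor_in_grid grid_floor_link) auto
  with tail[OF t y] tail[OF s x]
  have "\<bar>v t y - v s x\<bar> \<le> K * chain_weight n + 2 * (K * (chain_weight n * S))" by linarith
  then show ?thesis by (simp add: S_def algebra_simps)
qed

text \<open>The level is the \<open>n\<close> with \<open>2 powr - (n + 1) < \<rho> \<le> 2 powr - n\<close>; then \<open>n\<close> is of the order of \<open>ln (1 / \<rho>)\<close>.\<close>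

lemma chain_weight_le:
  assumes "0 < \<rho>" "\<rho> \<le> 1/2" "\<rho> * 2 ^ N \<le> 1"
  obtains n where "N \<le> n" "\<rho> * 2 ^ n \<le> 1" "chain_weight n \<le> 3 * sqrt (\<rho> * ln (1 / \<rho>))"
proof -
  define n where "n = nat \<lfloor>log 2 (1 / \<rho>)\<rfloor>"
  have l: "log 2 (1 / \<rho>) \<ge> 1"
    using assms by (subst le_log_iff) (auto simp: field_simps)
  then have n: "real n \<le> log 2 (1 / \<rho>)" "log 2 (1 / \<rho>) < real n + 1" "1 \<le> n"
    unfolding n_def by (auto simp: le_nat_floor)
  have "2 powr real n \<le> 1 / \<rho>" using n(1) assms by (subst (asm) le_log_iff) auto
  then have le: "2 ^ n \<le> 1 / \<rho>" by (simp add: powr_realpow)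
  have "1 / \<rho> < 2 powr (real n + 1)" using n(2) assms by (subst (asm) log_less_iff) auto
  then have gt: "1 / \<rho> < 2 * 2 ^ n" by (simp add: powr_add powr_realpow)
  have "2 ^ N \<le> 1 / \<rho>" using assms by (simp add: field_simps)
  also note gt
  finally have "(2::real) ^ N < 2 ^ Suc n" by simp
  then have Nn: "N \<le> n" by (subst (asm) power_strict_increasing_iff) auto
  have n1: "\<rho> * 2 ^ n \<le> 1" using le assms by (simp add: field_simps)
  have "real n * ln 2 \<le> ln (1 / \<rho>)" using n(1) by (simp add: log_def field_simps)
  moreover have "ln (2::real) \<ge> 1/2" using ln2_ge_two_thirds by simp
  ultimately have ln: "real n \<le> 2 * ln (1 / \<rho>)"
    using mult_left_mono[of "1/2" "ln 2" "real n"] by simp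
  have "real (n + 1) / 2 ^ n \<le> (2 * real n) * (2 * \<rho>)"
  proof -
    have "real (n + 1) \<le> 2 * real n" using n(3) by simp
    moreover have "1 / 2 ^ n \<le> 2 * \<rho>" using gt assms by (simp add: field_simps)
    ultimately have "real (n + 1) * (1 / 2 ^ n) \<le> (2 * real n) * (2 * \<rho>)"
      by (intro mult_mono) auto
    then show ?thesis by simp
  qed
  also have "\<dots> \<le> (2 * (2 * ln (1 / \<rho>))) * (2 * \<rho>)"
    using ln assms by (intro mult_mono) auto
  \<comment> \<open>the product is \<open>8 * (\<rho> * ln (1 / \<rho>))\<close>, rounded up to a factor with a rational square root\<close>
  also have "\<dots> \<le> 9 * (\<rho> * ln (1 / \<rho>))"
  proof -
    have "0 \<le> \<rho> * ln (1 / \<rho>)" using assms by (intro mult_nonneg_nonneg ln_ge_zero) (auto simp: field_simps)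
    then show ?thesis by simp
  qed
  finally have "chain_weight n \<le> sqrt (9 * (\<rho> * ln (1 / \<rho>)))"
    unfolding chain_weight_def by (rule real_sqrt_le_mono)
  also have "\<dots> = 3 * sqrt (\<rho> * ln (1 / \<rho>))" by (simp add: real_sqrt_mult)
  finally show ?thesis using that Nn n1 by blast
qed

lemma parabolic_modulus:
  assumes cont: "continuous_on ({0..T} \<times> UNIV) (\<lambda>(t, y). v t y)"
    and links: "\<And>n p q. N \<le> n \<Longrightarrow> p \<in> grid T a b n \<Longrightarrow> q \<in> grid T a b n \<Longrightarrow> grid_link p q \<Longrightarrow>
        \<bar>grid_value v n p - grid_value v n q\<bar> \<le> K * chain_weight n"
    and "K \<ge> 0" and ts: "t \<in> {0..T}" "s \<in> {0..T}" and yx: "y \<in> {a..b}" "x \<in> {a..b}"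
    and \<rho>: "0 < \<rho>" "\<rho> \<le> 1/2" "\<rho> * 2 ^ N \<le> 1" and close: "\<bar>t - s\<bar> \<le> \<rho>\<^sup>2" "\<bar>y - x\<bar> \<le> \<rho>"
  shows "\<bar>v t y - v s x\<bar> \<le> 3 * K * (1 + 2 * suminf chain_weight) * sqrt (\<rho> * ln (1 / \<rho>))"
proof -
  obtain n where n: "N \<le> n" "\<rho> * 2 ^ n \<le> 1" "chain_weight n \<le> 3 * sqrt (\<rho> * ln (1 / \<rho>))"
    using chain_weight_le[OF \<rho>] .
  have "\<bar>t - s\<bar> * 4 ^ n \<le> \<rho>\<^sup>2 * 4 ^ n" using close by (intro mult_right_mono) auto
  also have "\<dots> = (\<rho> * 2 ^ n)\<^sup>2"
    by (simp add: power_mult_distrib flip: power_mult) (simp add: mult.commute[of n] power_mult)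
  also have "\<dots> \<le> 1" using n(2) \<rho>(1) by (intro power_le_one) auto
  finally have 1: "\<bar>t - s\<bar> * 4 ^ n \<le> 1" .
  have "\<bar>y - x\<bar> * 2 ^ n \<le> \<rho> * 2 ^ n" using close by (intro mult_right_mono) auto
  with n(2) have 2: "\<bar>y - x\<bar> * 2 ^ n \<le> 1" by linarith
  have "\<bar>v t y - v s x\<bar> \<le> K * (1 + 2 * suminf chain_weight) * chain_weight n"
    by (rule chaining[OF cont links \<open>K \<ge> 0\<close> n(1) ts yx 1 2])
  also have "\<dots> \<le> K * (1 + 2 * suminf chain_weight) * (3 * sqrt (\<rho> * ln (1 / \<rho>)))"
    using n(3) \<open>K \<ge> 0\<close> suminf_nonneg[OF summable_chain_weight]
    by (intro mult_left_mono) auto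
  finally show ?thesis by (simp only: mult_ac)
qed

section \<open>Almost sure bounds on grid increments\<close>

lemma finite_grid [simp]: "finite (grid T a b n)"
  by (simp add: grid_def)

lemma grid_time: "p \<in> grid T a b n \<Longrightarrow> real_of_int (fst p) / 4 ^ n \<in> {0..T}"
  by (auto simp: grid_def le_floor_iff pos_divide_le_eq)

lemma card_grid_le:
  assumes "0 \<le> T" "a \<le> b"
  shows "real (card (grid T a b n)) \<le> (T + 1) * (b - a + 2) * 8 ^ n"
proof -
  have "real (nat (\<lfloor>T * 4 ^ n\<rfloor> + 1)) \<le> T * 4 ^ n + 1"
    using assms by (subst of_nat_nat) auto
  also have "\<dots> \<le> (T + 1) * 4 ^ n" by (simp add: algebra_simps)
  finally have 1: "real (nat (\<lfloor>T * 4 ^ n\<rfloor> + 1)) \<le> (T + 1) * 4 ^ n" .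
  have nat_le: "real (nat z) \<le> r" if "real_of_int z \<le> r" "0 \<le> r" for z r
    using that by (cases "0 \<le> z") auto
  have "real (nat (\<lfloor>b * 2 ^ n\<rfloor> - \<lceil>(a - 1) * 2 ^ n\<rceil> + 1)) \<le> (b - a + 1) * 2 ^ n + 1"
  proof (rule nat_le)
    have "(b - a + 1) * 2 ^ n = b * 2 ^ n - (a - 1) * 2 ^ n" by (simp add: algebra_simps)
    then show "real_of_int (\<lfloor>b * 2 ^ n\<rfloor> - \<lceil>(a - 1) * 2 ^ n\<rceil> + 1) \<le> (b - a + 1) * 2 ^ n + 1"
      using of_int_floor_le[of "b * 2 ^ n"] le_of_int_ceiling[of "(a - 1) * 2 ^ n"]
      unfolding of_int_diff of_int_add of_int_1 by linarith
    show "0 \<le> (b - a + 1) * 2 ^ n + 1" using assms by simp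
  qed
  also have "\<dots> \<le> (b - a + 2) * 2 ^ n" by (simp add: algebra_simps)
  finally have 2: "real (nat (\<lfloor>b * 2 ^ n\<rfloor> - \<lceil>(a - 1) * 2 ^ n\<rceil> + 1)) \<le> (b - a + 2) * 2 ^ n" .
  have "real (card (grid T a b n)) \<le> ((T + 1) * 4 ^ n) * ((b - a + 2) * 2 ^ n)"
    using mult_mono[OF 1 2] assms by (simp add: grid_def card_cartesian_product)
  also have "\<dots> = (T + 1) * (b - a + 2) * (4 ^ n * 2 ^ n)" by (simp only: mult_ac)
  also have "(4::real) ^ n * 2 ^ n = 8 ^ n" by (simp flip: power_mult_distrib)
  finally show ?thesis .
qed

lemma mild_solution_increment_tail:
  assumes "prob_space M" "brownian_sheet M W" "mild_solution M W T u"
    and "t \<in> {0..T}" "s \<in> {0..T}" "16 * (sqrt \<bar>t - s\<bar> + \<bar>x - y\<bar>) \<le> v" "v > 0" "l > 0"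
  shows "measure M {\<omega>\<in>space M. l \<le> \<bar>u t y \<omega> - u s x \<omega>\<bar>} \<le> sqrt 2 * exp (- l\<^sup>2 / (48 * v))"
proof (rule wiener_integral_diff_tail[OF assms(1,2)])
  show "is_wiener_integral M W (heat_integrand t y) (u t y)" "is_wiener_integral M W (heat_integrand s x) (u s x)"
    using assms by (auto simp: mild_solution_def heat_integrand_def)
  have "(\<integral>\<^sup>+ p. ennreal ((heat_integrand t y p - heat_integrand s x p)\<^sup>2) \<partial>lborel)
     \<le> ennreal (16 * (sqrt \<bar>t - s\<bar> + \<bar>x - y\<bar>))"
    using assms by (intro heat_integrand_increment) auto
  also have "\<dots> \<le> ennreal v" by (intro ennreal_leI) fact
  finally show "(\<integral>\<^sup>+ p. ennreal ((heat_integrand t y p - heat_integrand s x p)\<^sup>2) \<partial>lborel) \<le> ennreal v" .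
qed fact+

text \<open>Linked points of level \<open>n\<close> have an increment of variance at most \<open>v = 64 / 2 ^ n\<close>, and
\<open>48 * 64 = 3072\<close> is the constant of the tail bound for this variance. The choice makes the
probability of exceeding \<open>link_constant * chain_weight n\<close> of order \<open>128 powr - (n + 1)\<close>, which beats
the number of pairs of grid points, of order \<open>64 ^ n\<close>.\<close>

definition link_constant :: real where
  "link_constant = sqrt (3072 * ln 128)"

lemma link_constant_pos: "link_constant > 0"
  by (simp add: link_constant_def)

lemma grid_link_tail:
  assumes "prob_space M" "brownian_sheet M W" "mild_solution M W T u"
    and p: "p \<in> grid T a b n" and q: "q \<in> grid T a b n" and link: "grid_link p q"
  shows "measure M {\<omega>\<in>space M. link_constant * chain_weight n
       \<le> \<bar>grid_value (\<lambda>t y. u t y \<omega>) n p - grid_value (\<lambda>t y. u t y \<omega>) n q\<bar>} \<le> sqrt 2 * (1 / 128) ^ Suc n"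
proof -
  let ?t = "of_int (fst p) / 4 ^ n :: real" and ?s = "of_int (fst q) / 4 ^ n :: real"
  let ?y = "of_int (snd p) / 2 ^ n :: real" and ?x = "of_int (snd q) / 2 ^ n :: real"
  have "\<bar>?t - ?s\<bar> = \<bar>real_of_int (fst p - fst q)\<bar> / 4 ^ n"
    by (simp flip: diff_divide_distrib)
  also have "\<dots> \<le> 4 / 4 ^ n"
    using link unfolding grid_link_def by (intro divide_right_mono) (linarith, simp)
  also have "\<dots> = (2 / 2 ^ n)\<^sup>2"
    by (simp add: power_divide flip: power_mult) (simp add: mult.commute[of n] power_mult)
  finally have dt: "sqrt \<bar>?t - ?s\<bar> \<le> 2 / 2 ^ n" by (intro real_le_lsqrt) auto
  have "\<bar>?x - ?y\<bar> = \<bar>real_of_int (snd p - snd q)\<bar> / 2 ^ n"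
    by (simp add: abs_minus_commute flip: diff_divide_distrib)
  also have "\<dots> \<le> 2 / 2 ^ n"
    using link unfolding grid_link_def by (intro divide_right_mono) (linarith, simp)
  finally have dx: "\<bar>?x - ?y\<bar> \<le> 2 / 2 ^ n" .
  have "0 < chain_weight n" by (simp add: chain_weight_def)
  then have "measure M {\<omega>\<in>space M. link_constant * chain_weight n \<le> \<bar>u ?t ?y \<omega> - u ?s ?x \<omega>\<bar>}
     \<le> sqrt 2 * exp (- (link_constant * chain_weight n)\<^sup>2 / (48 * (64 / 2 ^ n)))"
    using dt dx link_constant_pos
    by (intro mild_solution_increment_tail[OF assms(1-3) grid_time[OF p] grid_time[OF q]]) auto
  also have "(link_constant * chain_weight n)\<^sup>2 = 3072 * ln 128 * (real (Suc n) / 2 ^ n)"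
    by (simp add: power_mult_distrib link_constant_def chain_weight_def)
  also have "- (3072 * ln 128 * (real (Suc n) / 2 ^ n)) / (48 * (64 / 2 ^ n)) = real (Suc n) * ln (1 / 128)"
    by (simp add: ln_div)
  also have "exp (real (Suc n) * ln (1 / 128)) = (1 / 128 :: real) ^ Suc n"
    by (subst exp_of_nat_mult) simp
  finally show ?thesis by (simp add: grid_value_def)
qed

lemma AE_grid_links:
  assumes "prob_space M" "brownian_sheet M W" "mild_solution M W T u" "0 \<le> T" "a \<le> b"
  shows "AE \<omega> in M. \<exists>N. \<forall>n\<ge>N. \<forall>p\<in>grid T a b n. \<forall>q\<in>grid T a b n. grid_link p q \<longrightarrow>
     \<bar>grid_value (\<lambda>t y. u t y \<omega>) n p - grid_value (\<lambda>t y. u t y \<omega>) n q\<bar> \<le> link_constant * chain_weight n"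
proof -
  interpret prob_space M by fact
  define P where "P = (\<lambda>n. {(p, q) \<in> grid T a b n \<times> grid T a b n. grid_link p q})"
  define E where "E = (\<lambda>n (p, q). {\<omega>\<in>space M. link_constant * chain_weight n
       \<le> \<bar>grid_value (\<lambda>t y. u t y \<omega>) n p - grid_value (\<lambda>t y. u t y \<omega>) n q\<bar>})"
  define C where "C = (T + 1) * (b - a + 2)"
  have finP: "finite (P n)" for n
    unfolding P_def by (rule finite_subset[of _ "grid T a b n \<times> grid T a b n"]) auto
  have "card (P n) \<le> card (grid T a b n \<times> grid T a b n)" for n
    unfolding P_def by (intro card_mono) auto
  then have cardP: "real (card (P n)) \<le> C\<^sup>2 * 64 ^ n" for n
  proof -
    have "real (card (P n)) \<le> real (card (grid T a b n)) * real (card (grid T a b n))"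
      using \<open>card (P n) \<le> _\<close> by (simp add: card_cartesian_product flip: of_nat_mult)
    also have "\<dots> \<le> (C * 8 ^ n) * (C * 8 ^ n)"
      using card_grid_le[OF assms(4,5), of n] assms(4,5) unfolding C_def by (intro mult_mono) auto
    also have "\<dots> = C\<^sup>2 * (8 ^ n * 8 ^ n)" by (simp add: power2_eq_square)
    also have "(8::real) ^ n * 8 ^ n = 64 ^ n" by (simp flip: power_mult_distrib)
    finally show ?thesis .
  qed
  have meas: "u t y \<in> borel_measurable M" if "t \<in> {0..T}" for t y
    using assms(3) that by (auto simp: mild_solution_def is_wiener_integral_def)
  have E: "E n pq \<in> sets M" "measure M (E n pq) \<le> sqrt 2 * (1 / 128) ^ Suc n" if "pq \<in> P n" for n pq
  proof -
    define p q where "p = fst pq" and "q = snd pq"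
    then have pq: "pq = (p, q)" "p \<in> grid T a b n" "q \<in> grid T a b n" "grid_link p q"
      using that by (auto simp: P_def)
    note [measurable] = meas[OF grid_time[OF pq(2)]] meas[OF grid_time[OF pq(3)]]
    show "E n pq \<in> sets M" unfolding E_def pq(1) grid_value_def by simp
    show "measure M (E n pq) \<le> sqrt 2 * (1 / 128) ^ Suc n"
      using grid_link_tail[OF assms(1-3) pq(2-4)] by (simp add: E_def pq(1))
  qed
  define B where "B = (\<lambda>n. \<Union>pq\<in>P n. E n pq)"
  have B: "B n \<in> sets M" for n
    unfolding B_def using E(1) finP by auto
  have "measure M (B n) \<le> C\<^sup>2 * sqrt 2 * (1 / 2) ^ n" for n
  proof -
    have "measure M (B n) \<le> (\<Sum>pq\<in>P n. measure M (E n pq))"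
      unfolding B_def using E(1) finP by (intro finite_measure_subadditive_finite) auto
    also have "\<dots> \<le> (\<Sum>pq\<in>P n. sqrt 2 * (1 / 128) ^ Suc n)"
      by (intro sum_mono E(2))
    also have "\<dots> = real (card (P n)) * (sqrt 2 * (1 / 128) ^ Suc n)" by simp
    also have "\<dots> \<le> (C\<^sup>2 * 64 ^ n) * (sqrt 2 * (1 / 128) ^ n)"
      by (intro mult_mono cardP) auto
    also have "\<dots> = C\<^sup>2 * sqrt 2 * (64 ^ n * (1 / 128) ^ n)" by simp
    also have "(64::real) ^ n * (1 / 128) ^ n = (1 / 2) ^ n" by (simp flip: power_mult_distrib)
    finally show ?thesis .
  qed
  then have small: "norm (measure M (B n)) \<le> C\<^sup>2 * sqrt 2 * (1 / 2) ^ n" for n by simp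
  have "summable (\<lambda>n. C\<^sup>2 * sqrt 2 * (1 / 2) ^ n)" by (intro summable_mult summable_geometric) simp
  then have "summable (\<lambda>n. measure M (B n))"
    using small by (rule summable_comparison_test')
  then have "AE \<omega> in M. eventually (\<lambda>n. \<omega> \<in> space M - B n) sequentially"
    using B by (intro borel_cantelli_AE1) (auto simp: emeasure_eq_measure)
  then show ?thesis
  proof eventually_elim
    case (elim \<omega>)
    then obtain N where N: "\<And>n. n \<ge> N \<Longrightarrow> \<omega> \<in> space M - B n" by (auto simp: eventually_sequentially)
    show ?case
    proof (intro exI[of _ N] allI impI ballI)
      fix n p q assume "N \<le> n" "p \<in> grid T a b n" "q \<in> grid T a b n" "grid_link p q"
      then have "(p, q) \<in> P n" by (simp add: P_def)
      then have "\<omega> \<notin> E n (p, q)" "\<omega> \<in> space M" using N[OF \<open>N \<le> n\<close>] unfolding B_def by blast+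
      then show "\<bar>grid_value (\<lambda>t y. u t y \<omega>) n p - grid_value (\<lambda>t y. u t y \<omega>) n q\<bar> \<le> link_constant * chain_weight n"
        by (simp add: E_def)
    qed
  qed
qed

section \<open>The modulus of the rectangular increments\<close>

text \<open>The factor \<open>6\<close> is \<open>2\<close>, for the two increments that form a rectangular one, times the factor \<open>3\<close>
lost in \<open>chain_weight_le\<close>.\<close>

definition modulus_constant :: real where
  "modulus_constant = 6 * link_constant * (1 + 2 * suminf chain_weight)"

lemma modulus_constant_nonneg: "modulus_constant \<ge> 0"
  using link_constant_pos suminf_nonneg[OF summable_chain_weight] by (simp add: modulus_constant_def)

text \<open>Each of the two bounds asks for only one of the two distances to be small. For a fixed \<open>\<delta>\<close> the quotient has
to be estimated also where just one of them is.\<close>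

definition small_increment_bounds ::
  "real \<Rightarrow> real \<Rightarrow> real \<Rightarrow> real \<Rightarrow> real \<Rightarrow> (real \<Rightarrow> real \<Rightarrow> 'a \<Rightarrow> real) \<Rightarrow> 'a \<Rightarrow> bool" where
  "small_increment_bounds C \<eta> T a b u \<omega> \<longleftrightarrow>
    (\<forall>s\<in>{0..T}. \<forall>t\<in>{0..T}. \<forall>x\<in>{a..b}. \<forall>y\<in>{a..b}.
      (0 < \<bar>t - s\<bar> \<and> \<bar>t - s\<bar> \<le> \<eta> \<longrightarrow> \<bar>rect_increment u s t x y \<omega>\<bar>
         \<le> C * (\<bar>t - s\<bar> powr (1/4) * ln (1 / \<bar>t - s\<bar>) powr (1/2))) \<and>
      (0 < \<bar>x - y\<bar> \<and> \<bar>x - y\<bar> \<le> \<eta> \<longrightarrow> \<bar>rect_increment u s t x y \<omega>\<bar>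
         \<le> C * (\<bar>x - y\<bar> powr (1/2) * ln (1 / \<bar>x - y\<bar>) powr (1/2))))"

text \<open>A rectangular increment is the difference of the time increments at \<open>y\<close> and at \<open>x\<close>, and also of the
space increments at \<open>t\<close> and at \<open>s\<close>. The two bounds are the parabolic modulus for \<open>\<rho> = sqrt \<bar>t - s\<bar>\<close>
and for \<open>\<rho> = \<bar>x - y\<bar>\<close>. The constant is deterministic; only the range \<open>\<eta>\<close> of validity is random.\<close>

lemma AE_rect_increment_bounds:
  assumes "prob_space M" "brownian_sheet M W" "mild_solution M W T u" "continuous_paths M T u" "0 \<le> T" "a \<le> b"
  shows "AE \<omega> in M. continuous_on ({0..T} \<times> UNIV) (\<lambda>(t, y). u t y \<omega>) \<and>
    (\<exists>\<eta>>0. \<eta> < 1 \<and> small_increment_bounds modulus_constant \<eta> T a b u \<omega>)"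
proof -
  have "AE \<omega> in M. continuous_on ({0..T} \<times> UNIV) (\<lambda>(t, y). u t y \<omega>)"
    using assms(4) by (simp add: continuous_paths_def)
  then show ?thesis using AE_grid_links[OF assms(1-3,5,6)]
  proof eventually_elim
    case (elim \<omega>)
    let ?v = "\<lambda>t y. u t y \<omega>"
    from elim(2) obtain N where N: "\<And>n p q. N \<le> n \<Longrightarrow> p \<in> grid T a b n \<Longrightarrow> q \<in> grid T a b n \<Longrightarrow> grid_link p q \<Longrightarrow>
        \<bar>grid_value ?v n p - grid_value ?v n q\<bar> \<le> link_constant * chain_weight n"
      by blast
    \<comment> \<open>the exponent \<open>Suc N\<close> instead of \<open>N\<close> makes \<open>r \<le> 1 / 2\<close> also for \<open>N = 0\<close>\<close>
    define r where "r = (1 / 2 :: real) ^ Suc N"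
    have r: "0 < r" "r \<le> 1 / 2" "r * 2 ^ N \<le> 1"
    proof -
      show "0 < r" by (simp add: r_def)
      have "(1 / 2 :: real) ^ Suc N \<le> (1 / 2) ^ 1" by (intro power_decreasing) auto
      then show "r \<le> 1 / 2" by (simp add: r_def)
      show "r * 2 ^ N \<le> 1" by (simp add: r_def power_divide)
    qed
    have modulus: "\<bar>?v t y - ?v s x\<bar> \<le> modulus_constant / 2 * sqrt (\<rho> * ln (1 / \<rho>))"
      if "t \<in> {0..T}" "s \<in> {0..T}" "y \<in> {a..b}" "x \<in> {a..b}" "0 < \<rho>" "\<rho> \<le> r" "\<bar>t - s\<bar> \<le> \<rho>\<^sup>2" "\<bar>y - x\<bar> \<le> \<rho>"
      for t s y x \<rho>
    proof -
      have "\<rho> * 2 ^ N \<le> r * 2 ^ N" using that by (intro mult_right_mono) auto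
      then have "\<rho> * 2 ^ N \<le> 1" using r by linarith
      then have "\<bar>?v t y - ?v s x\<bar> \<le> 3 * link_constant * (1 + 2 * suminf chain_weight) * sqrt (\<rho> * ln (1 / \<rho>))"
        using that r link_constant_pos by (intro parabolic_modulus[OF elim(1) N]) auto
      then show ?thesis by (simp add: modulus_constant_def)
    qed
    \<comment> \<open>\<open>\<bar>t - s\<bar> \<le> r\<^sup>2\<close> is what a parabolic distance of at most \<open>r\<close> needs, and \<open>r\<^sup>2 \<le> r\<close> suffices for space\<close>
    define \<eta> where "\<eta> = r\<^sup>2"
    have \<eta>r: "\<eta> \<le> r" unfolding \<eta>_def power2_eq_square using r mult_left_mono[of r 1 r] by simp
    show ?case
      unfolding small_increment_bounds_def
    proof (intro conjI exI[of _ \<eta>] ballI impI)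
      show "continuous_on ({0..T} \<times> UNIV) (\<lambda>(t, y). u t y \<omega>)" by (rule elim(1))
      show "0 < \<eta>" using r by (simp add: \<eta>_def)
      show "\<eta> < 1" using \<eta>r r by linarith
      fix s t x y assume st: "s \<in> {0..T}" "t \<in> {0..T}" and xy: "x \<in> {a..b}" "y \<in> {a..b}"
      {
        assume h: "0 < \<bar>t - s\<bar> \<and> \<bar>t - s\<bar> \<le> \<eta>"
        define \<rho> where "\<rho> = sqrt \<bar>t - s\<bar>"
        have \<rho>: "0 < \<rho>" "\<rho>\<^sup>2 = \<bar>t - s\<bar>" using h by (auto simp: \<rho>_def)
        have "\<rho> \<le> sqrt (r\<^sup>2)" unfolding \<rho>_def using h by (intro real_sqrt_le_mono) (simp add: \<eta>_def)
        then have "\<rho> \<le> r" using r by simp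
        have "\<bar>?v t y - ?v s y\<bar> \<le> modulus_constant / 2 * sqrt (\<rho> * ln (1 / \<rho>))"
          "\<bar>?v t x - ?v s x\<bar> \<le> modulus_constant / 2 * sqrt (\<rho> * ln (1 / \<rho>))"
          using st xy \<rho> \<open>\<rho> \<le> r\<close> by (intro modulus; simp)+
        then have "\<bar>rect_increment u s t x y \<omega>\<bar> \<le> modulus_constant * sqrt (\<rho> * ln (1 / \<rho>))"
          unfolding rect_increment_def by linarith
        also have "\<dots> \<le> modulus_constant * (\<bar>t - s\<bar> powr (1/4) * ln (1 / \<bar>t - s\<bar>) powr (1/2))"
        proof (intro mult_left_mono modulus_constant_nonneg)
          have l: "ln (1 / \<bar>t - s\<bar>) = 2 * ln (1 / \<rho>)"
            using \<rho> by (simp add: ln_div ln_realpow flip: \<rho>(2))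
          have "0 \<le> ln (1 / \<rho>)" using \<rho> \<open>\<rho> \<le> r\<close> r by (intro ln_ge_zero) (simp add: field_simps)
          then have "sqrt (ln (1 / \<rho>)) \<le> ln (1 / \<bar>t - s\<bar>) powr (1/2)"
            unfolding l by (subst powr_half_sqrt) auto
          moreover have "sqrt \<rho> = \<bar>t - s\<bar> powr (1/4)"
            using \<rho>(1) by (simp add: powr_powr powr_half_sqrt[symmetric] \<rho>_def)
          ultimately show "sqrt (\<rho> * ln (1 / \<rho>)) \<le> \<bar>t - s\<bar> powr (1/4) * ln (1 / \<bar>t - s\<bar>) powr (1/2)"
            by (simp add: real_sqrt_mult mult_left_mono)
        qed
        finally show "\<bar>rect_increment u s t x y \<omega>\<bar>
         \<le> modulus_constant * (\<bar>t - s\<bar> powr (1/4) * ln (1 / \<bar>t - s\<bar>) powr (1/2))" .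
      }
      {
        assume k: "0 < \<bar>x - y\<bar> \<and> \<bar>x - y\<bar> \<le> \<eta>"
        define \<rho> where "\<rho> = \<bar>x - y\<bar>"
        have \<rho>: "0 < \<rho>" "\<rho> \<le> r" using k \<eta>r by (auto simp: \<rho>_def)
        have "\<bar>?v t y - ?v t x\<bar> \<le> modulus_constant / 2 * sqrt (\<rho> * ln (1 / \<rho>))"
          "\<bar>?v s y - ?v s x\<bar> \<le> modulus_constant / 2 * sqrt (\<rho> * ln (1 / \<rho>))"
          using st xy \<rho> by (intro modulus; simp add: \<rho>_def abs_minus_commute)+
        then have "\<bar>rect_increment u s t x y \<omega>\<bar> \<le> modulus_constant * sqrt (\<rho> * ln (1 / \<rho>))"
          unfolding rect_increment_def by linarith
        also have "sqrt (\<rho> * ln (1 / \<rho>)) = \<bar>x - y\<bar> powr (1/2) * ln (1 / \<bar>x - y\<bar>) powr (1/2)"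
        proof -
          have "0 \<le> ln (1 / \<rho>)" using \<rho> r by (intro ln_ge_zero) (simp add: field_simps)
          then show ?thesis using \<rho> by (simp add: real_sqrt_mult powr_half_sqrt \<rho>_def)
        qed
        finally show "\<bar>rect_increment u s t x y \<omega>\<bar>
         \<le> modulus_constant * (\<bar>x - y\<bar> powr (1/2) * ln (1 / \<bar>x - y\<bar>) powr (1/2))" .
      }
    qed
  qed
qed

text \<open>The geometric mean of the two bounds with weights \<open>1 - 4 * \<alpha>\<close> and \<open>4 * \<alpha>\<close>.\<close>

lemma interpolation_bound:
  fixes R C h k L \<alpha> :: real
  assumes "0 \<le> R" "0 \<le> C" "0 < h" "0 < k" "0 \<le> L" "0 \<le> \<alpha>" "\<alpha> \<le> 1/4"
    and h: "R \<le> C * (h powr (1/4) * L powr (1/2))" and k: "R \<le> C * (k powr (1/2) * L powr (1/2))"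
  shows "R \<le> C * (h powr (1/4 - \<alpha>) * k powr (2 * \<alpha>) * L powr (1/2))"
proof (cases "R = 0")
  case True
  then show ?thesis using assms by (simp add: mult_nonneg_nonneg)
next
  case False
  define \<theta> where "\<theta> = 4 * \<alpha>"
  have \<theta>: "0 \<le> \<theta>" "\<theta> \<le> 1" using assms by (auto simp: \<theta>_def)
  have "C \<noteq> 0" "L \<noteq> 0" using h False assms by (auto intro!: notI)
  then have pos: "C > 0" "L > 0" using assms by auto
  have "R = R powr (1 - \<theta>) * R powr \<theta>"
    using False assms by (simp flip: powr_add)
  also have "\<dots> \<le> (C * (h powr (1/4) * L powr (1/2))) powr (1 - \<theta>) * (C * (k powr (1/2) * L powr (1/2))) powr \<theta>"
    using assms \<theta> by (intro mult_mono powr_mono2) auto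
  also have "\<dots> = (C powr (1 - \<theta>) * C powr \<theta>) * (h powr (1/4 * (1 - \<theta>)) * k powr (1/2 * \<theta>)
      * (L powr (1/2 * (1 - \<theta>)) * L powr (1/2 * \<theta>)))"
    using assms by (simp add: powr_mult powr_powr)
  also have "C powr (1 - \<theta>) * C powr \<theta> = C" using pos by (simp flip: powr_add)
  also have "L powr (1/2 * (1 - \<theta>)) * L powr (1/2 * \<theta>) = L powr (1/2)"
    by (simp add: algebra_simps diff_divide_distrib flip: powr_add)
  also have "1/4 * (1 - \<theta>) = 1/4 - \<alpha>" by (simp add: \<theta>_def)
  also have "1/2 * \<theta> = 2 * \<alpha>" by (simp add: \<theta>_def)
  finally show ?thesis .
qed

definition increment_quotient :: "real \<Rightarrow> (real \<Rightarrow> real \<Rightarrow> 'a \<Rightarrow> real) \<Rightarrow> 'a \<Rightarrow> real \<times> real \<times> real \<times> real \<Rightarrow> real" where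
  "increment_quotient \<alpha> u \<omega> = (\<lambda>(s, t, x, y). \<bar>rect_increment u s t x y \<omega>\<bar> /
          (\<bar>t - s\<bar> powr (1/4 - \<alpha>) * \<bar>x - y\<bar> powr (2 * \<alpha>) * \<bar>ln (\<bar>t - s\<bar> * \<bar>x - y\<bar>)\<bar> powr (1/2)))"

lemma increment_modulus_alt:
  "increment_modulus \<alpha> u T a b \<delta> \<omega> = (SUP p\<in>increment_range T a b \<delta>. ereal (increment_quotient \<alpha> u \<omega> p))"
  unfolding increment_modulus_def increment_quotient_def by (intro SUP_cong) auto

lemma increment_modulus_mono: "\<delta> \<le> \<delta>' \<Longrightarrow> increment_modulus \<alpha> u T a b \<delta> \<omega> \<le> increment_modulus \<alpha> u T a b \<delta>' \<omega>"
  unfolding increment_modulus_alt by (intro SUP_subset_mono) (auto simp: increment_range_def)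

lemma increment_modulus_le:
  assumes "0 \<le> C" "0 \<le> \<alpha>" "\<alpha> \<le> 1/4"
    and bounds: "\<And>s t x y. (s, t, x, y) \<in> increment_range T a b \<delta> \<Longrightarrow> ln (\<bar>t - s\<bar> * \<bar>x - y\<bar>) \<noteq> 0 \<and>
      \<bar>rect_increment u s t x y \<omega>\<bar> \<le> C * (\<bar>t - s\<bar> powr (1/4) * \<bar>ln (\<bar>t - s\<bar> * \<bar>x - y\<bar>)\<bar> powr (1/2)) \<and>
      \<bar>rect_increment u s t x y \<omega>\<bar> \<le> C * (\<bar>x - y\<bar> powr (1/2) * \<bar>ln (\<bar>t - s\<bar> * \<bar>x - y\<bar>)\<bar> powr (1/2))"
  shows "increment_modulus \<alpha> u T a b \<delta> \<omega> \<le> ereal C"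
  unfolding increment_modulus_alt
proof (rule SUP_least)
  fix p assume "p \<in> increment_range T a b \<delta>"
  moreover obtain s t x y where p: "p = (s, t, x, y)" by (cases p)
  ultimately have r: "(s, t, x, y) \<in> increment_range T a b \<delta>" by simp
  then have pos: "0 < \<bar>t - s\<bar>" "0 < \<bar>x - y\<bar>" by (auto simp: increment_range_def)
  let ?D = "\<bar>t - s\<bar> powr (1/4 - \<alpha>) * \<bar>x - y\<bar> powr (2 * \<alpha>) * \<bar>ln (\<bar>t - s\<bar> * \<bar>x - y\<bar>)\<bar> powr (1/2)"
  have "\<bar>rect_increment u s t x y \<omega>\<bar> \<le> C * ?D"
    using bounds[OF r] by (intro interpolation_bound[OF _ assms(1) pos _ assms(2,3)]) (simp_all only: abs_ge_zero)
  moreover have "0 < ?D"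
  proof -
    have "0 < \<bar>ln (\<bar>t - s\<bar> * \<bar>x - y\<bar>)\<bar> powr (1/2)" using bounds[OF r] by simp
    then show ?thesis using pos by (intro mult_pos_pos) auto
  qed
  ultimately have "\<bar>rect_increment u s t x y \<omega>\<bar> / ?D \<le> C" by (simp add: pos_divide_le_eq)
  then show "ereal (increment_quotient \<alpha> u \<omega> p) \<le> ereal C" by (simp add: increment_quotient_def p)
qed

lemma mono_tendsto_at_right_0:
  fixes f :: "real \<Rightarrow> ereal"
  assumes mono: "\<And>x y. x \<le> y \<Longrightarrow> f x \<le> f y"
  shows "(f \<longlongrightarrow> (INF x\<in>{0<..}. f x)) (at_right 0)"
proof (rule order_tendstoI)
  fix l assume "l < (INF x\<in>{0<..}. f x)"
  then have "l < f x" if "x > 0" for x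
    using that by (auto intro: less_le_trans INF_lower)
  then show "eventually (\<lambda>x. l < f x) (at_right 0)"
    using eventually_at_right_less[of "0::real"] by (auto elim: eventually_mono)
next
  fix l assume "(INF x\<in>{0<..}. f x) < l"
  then obtain d where d: "d > 0" "f d < l" by (auto simp: INF_less_iff)
  show "eventually (\<lambda>x. f x < l) (at_right 0)"
    using eventually_at_right_real[OF d(1)]
    by (rule eventually_mono) (auto intro: le_less_trans[OF mono d(2)])
qed

text \<open>The modulus decreases with \<open>\<delta>\<close>, so the limit exists and is at most the value at \<open>\<eta>\<close>. As both distances
are then below \<open>1\<close>, the two logarithms have the same sign and \<open>\<bar>ln (\<bar>t - s\<bar> * \<bar>x - y\<bar>)\<bar>\<close> is at least
\<open>ln (1 / \<bar>t - s\<bar>)\<close> and \<open>ln (1 / \<bar>x - y\<bar>)\<close>.\<close>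

lemma increment_modulus_limit:
  assumes "0 \<le> \<alpha>" "\<alpha> \<le> 1/4" "0 < \<eta>" "\<eta> < 1"
    and bounds: "small_increment_bounds C \<eta> T a b u \<omega>"
    and "0 \<le> C"
  shows "\<exists>L. ((\<lambda>\<delta>. increment_modulus \<alpha> u T a b \<delta> \<omega>) \<longlongrightarrow> L) (at_right 0) \<and> L \<le> ereal C"
proof (intro exI conjI)
  show "((\<lambda>\<delta>. increment_modulus \<alpha> u T a b \<delta> \<omega>) \<longlongrightarrow> (INF \<delta>\<in>{0<..}. increment_modulus \<alpha> u T a b \<delta> \<omega>)) (at_right 0)"
    by (intro mono_tendsto_at_right_0 increment_modulus_mono)
  have "(INF \<delta>\<in>{0<..}. increment_modulus \<alpha> u T a b \<delta> \<omega>) \<le> increment_modulus \<alpha> u T a b \<eta> \<omega>"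
    using \<open>0 < \<eta>\<close> by (intro INF_lower) auto
  also have "\<dots> \<le> ereal C"
  proof (rule increment_modulus_le)
    fix s t x y assume "(s, t, x, y) \<in> increment_range T a b \<eta>"
    then have r: "s \<in> {0..T}" "t \<in> {0..T}" "x \<in> {a..b}" "y \<in> {a..b}"
      and h: "0 < \<bar>t - s\<bar>" "\<bar>t - s\<bar> \<le> \<eta>" and k: "0 < \<bar>x - y\<bar>" "\<bar>x - y\<bar> \<le> \<eta>"
      by (auto simp: increment_range_def)
    define h' k' where "h' = \<bar>t - s\<bar>" and "k' = \<bar>x - y\<bar>"
    have hk: "0 < h'" "h' < 1" "0 < k'" "k' < 1" using h k \<open>\<eta> < 1\<close> by (auto simp: h'_def k'_def)
    then have neg: "ln h' < 0" "ln k' < 0" by auto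
    have L: "\<bar>ln (h' * k')\<bar> = - ln h' - ln k'" 
    proof -
      have "ln (h' * k') = ln h' + ln k'" using hk by (simp add: ln_mult)
      then show ?thesis using neg by linarith
    qed
    have lh: "ln (1 / h') powr (1/2) \<le> \<bar>ln (h' * k')\<bar> powr (1/2)"
      using neg hk unfolding L by (intro powr_mono2) (auto simp: ln_div)
    have lk: "ln (1 / k') powr (1/2) \<le> \<bar>ln (h' * k')\<bar> powr (1/2)"
      using neg hk unfolding L by (intro powr_mono2) (auto simp: ln_div)
    have "\<bar>rect_increment u s t x y \<omega>\<bar> \<le> C * (h' powr (1/4) * ln (1 / h') powr (1/2))"
      using bounds r h unfolding h'_def small_increment_bounds_def by blast
    also have "\<dots> \<le> C * (h' powr (1/4) * \<bar>ln (h' * k')\<bar> powr (1/2))"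
      using lh \<open>0 \<le> C\<close> by (intro mult_left_mono) auto
    finally have 1: "\<bar>rect_increment u s t x y \<omega>\<bar> \<le> C * (h' powr (1/4) * \<bar>ln (h' * k')\<bar> powr (1/2))" .
    have "\<bar>rect_increment u s t x y \<omega>\<bar> \<le> C * (k' powr (1/2) * ln (1 / k') powr (1/2))"
      using bounds r k unfolding k'_def small_increment_bounds_def by blast
    also have "\<dots> \<le> C * (k' powr (1/2) * \<bar>ln (h' * k')\<bar> powr (1/2))"
      using lk \<open>0 \<le> C\<close> by (intro mult_left_mono) auto
    finally have 2: "\<bar>rect_increment u s t x y \<omega>\<bar> \<le> C * (k' powr (1/2) * \<bar>ln (h' * k')\<bar> powr (1/2))" .
    have "ln (h' * k') \<noteq> 0" using L neg by auto
    with 1 2 show "ln (\<bar>t - s\<bar> * \<bar>x - y\<bar>) \<noteq> 0 \<and>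
      \<bar>rect_increment u s t x y \<omega>\<bar> \<le> C * (\<bar>t - s\<bar> powr (1/4) * \<bar>ln (\<bar>t - s\<bar> * \<bar>x - y\<bar>)\<bar> powr (1/2)) \<and>
      \<bar>rect_increment u s t x y \<omega>\<bar> \<le> C * (\<bar>x - y\<bar> powr (1/2) * \<bar>ln (\<bar>t - s\<bar> * \<bar>x - y\<bar>)\<bar> powr (1/2))"
      unfolding h'_def k'_def by blast
  qed fact+
  finally show "(INF \<delta>\<in>{0<..}. increment_modulus \<alpha> u T a b \<delta> \<omega>) \<le> ereal C" .
qed

text \<open>The product \<open>\<bar>t - s\<bar> * \<bar>x - y\<bar>\<close> takes every value in \<open>(0, m]\<close>, where \<open>m = min T \<delta> * min (b - a) \<delta>\<close>.
If \<open>m \<ge> 1\<close>, it would take the value \<open>1\<close>, at which the logarithm vanishes.\<close>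

lemma increment_range_log_gap:
  assumes "0 < T" "a < b" "0 < \<delta>"
    and nz: "\<forall>(s, t, x, y) \<in> increment_range T a b \<delta>. ln (\<bar>t - s\<bar> * \<bar>x - y\<bar>) \<noteq> 0"
  obtains l where "0 < l"
    "\<forall>(s, t, x, y) \<in> increment_range T a b \<delta>. ln (\<bar>t - s\<bar> * \<bar>x - y\<bar>) \<le> - l"
proof -
  define h k where "h = min T \<delta>" and "k = min (b - a) \<delta>"
  have hk: "0 < h" "0 < k" using assms by (auto simp: h_def k_def)
  have "h * k < 1"
  proof (rule ccontr)
    assume "\<not> h * k < 1"
    then have le: "1 / h \<le> k" using hk by (simp add: field_simps)
    have "(0, h, a, a + 1 / h) \<in> increment_range T a b \<delta>"
      using assms(1-3) hk le unfolding increment_range_def by (auto simp: h_def k_def)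
    then have "ln (\<bar>h - 0\<bar> * \<bar>a - (a + 1 / h)\<bar>) \<noteq> 0" using nz by blast
    then show False using hk by simp
  qed
  show ?thesis
  proof
    show "0 < - ln (h * k)" using hk \<open>h * k < 1\<close> by simp
    have "ln (\<bar>t - s\<bar> * \<bar>x - y\<bar>) \<le> - (- ln (h * k))" if "(s, t, x, y) \<in> increment_range T a b \<delta>" for s t x y
    proof -
      from that have "\<bar>t - s\<bar> \<le> h" "\<bar>x - y\<bar> \<le> k" "0 < \<bar>t - s\<bar>" "0 < \<bar>x - y\<bar>"
        by (auto simp: increment_range_def h_def k_def)
      then have "\<bar>t - s\<bar> * \<bar>x - y\<bar> \<le> h * k" "0 < \<bar>t - s\<bar> * \<bar>x - y\<bar>"
        by (auto intro!: mult_mono mult_pos_pos)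
      then show ?thesis
        using hk by (simp add: ln_le_cancel_iff)
    qed
    then show "\<forall>(s, t, x, y) \<in> increment_range T a b \<delta>. ln (\<bar>t - s\<bar> * \<bar>x - y\<bar>) \<le> - (- ln (h * k))"
      by blast
  qed
qed

text \<open>Passage from small \<open>g\<close>, where the modulus of continuity is available, to all \<open>g\<close>, where only the
bound \<open>S\<close> is: for \<open>g > \<eta>\<close> the factors \<open>g powr p\<close> and \<open>L powr (1/2)\<close> are bounded below. The same
lemma serves for time (\<open>p = 1/4\<close>) and for space (\<open>p = 1/2\<close>).\<close>

lemma extend_local_bound:
  fixes R C S g p \<eta> l L A :: real
  assumes "0 \<le> C" "0 \<le> S" "0 < p" "0 < \<eta>" "\<eta> < 1" "0 < l" "l \<le> L" "0 \<le> A" "0 < g"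
    and local: "g \<le> \<eta> \<Longrightarrow> R \<le> C * (g powr p * ln (1 / g) powr (1/2))"
    and "R \<le> S" and log: "ln (1 / g) \<le> A * L"
  shows "R \<le> (C * A powr (1/2) + S / (\<eta> powr p * l powr (1/2))) * (g powr p * L powr (1/2))"
proof (cases "g \<le> \<eta>")
  case True
  have "R \<le> C * (g powr p * ln (1 / g) powr (1/2))" by (rule local[OF True])
  also have "\<dots> \<le> C * (g powr p * (A * L) powr (1/2))"
    using assms True by (intro mult_left_mono powr_mono2 ln_ge_zero) auto
  also have "\<dots> = (C * A powr (1/2)) * (g powr p * L powr (1/2))"
    using assms by (simp add: powr_mult)
  also have "\<dots> \<le> (C * A powr (1/2) + S / (\<eta> powr p * l powr (1/2))) * (g powr p * L powr (1/2))"
    using assms by (intro mult_right_mono) auto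
  finally show ?thesis .
next
  case False
  have "R \<le> S / (\<eta> powr p * l powr (1/2)) * (\<eta> powr p * l powr (1/2))"
    using assms by simp
  also have "\<dots> \<le> S / (\<eta> powr p * l powr (1/2)) * (g powr p * L powr (1/2))"
    using assms False by (intro mult_left_mono mult_mono powr_mono2) auto
  also have "\<dots> \<le> (C * A powr (1/2) + S / (\<eta> powr p * l powr (1/2))) * (g powr p * L powr (1/2))"
    using assms by (intro mult_right_mono) auto
  finally show ?thesis .
qed

text \<open>For distances that are not small, \<open>L = \<bar>ln (\<bar>t - s\<bar> * \<bar>x - y\<bar>)\<bar>\<close> need not dominate the logarithm
of one distance alone, because the other distance may exceed \<open>1\<close>. But the excess is at most
\<open>\<bar>ln T\<bar> + \<bar>ln (b - a)\<bar>\<close>, and since \<open>L\<close> is bounded below by the gap \<open>l\<close>, it costs only the factor \<open>A\<close>.\<close>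

lemma increment_modulus_finite:
  assumes "0 \<le> \<alpha>" "\<alpha> \<le> 1/4" "0 < \<eta>" "\<eta> < 1" "0 \<le> C" "0 < T" "a < b" "0 < \<delta>"
    and cont: "continuous_on ({0..T} \<times> UNIV) (\<lambda>(t, y). u t y \<omega>)"
    and bounds: "small_increment_bounds C \<eta> T a b u \<omega>"
    and nz: "\<forall>(s, t, x, y) \<in> increment_range T a b \<delta>. ln (\<bar>t - s\<bar> * \<bar>x - y\<bar>) \<noteq> 0"
  shows "\<exists>c. increment_modulus \<alpha> u T a b \<delta> \<omega> \<le> ereal c"
proof -
  obtain l where l: "0 < l"
    "\<forall>(s, t, x, y) \<in> increment_range T a b \<delta>. ln (\<bar>t - s\<bar> * \<bar>x - y\<bar>) \<le> - l"
    using increment_range_log_gap[OF assms(6-8) nz] .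
  have "compact ((\<lambda>(t, y). u t y \<omega>) ` ({0..T} \<times> {a..b}))"
    by (intro compact_continuous_image continuous_on_subset[OF cont] compact_Times) auto
  then have "bounded ((\<lambda>(t, y). u t y \<omega>) ` ({0..T} \<times> {a..b}))" by (rule compact_imp_bounded)
  then obtain S where "0 < S" and S: "\<forall>z\<in>(\<lambda>(t, y). u t y \<omega>) ` ({0..T} \<times> {a..b}). norm z \<le> S"
    by (auto simp: bounded_pos)
  define A where "A = 1 + (\<bar>ln T\<bar> + \<bar>ln (b - a)\<bar>) / l"
  have "A \<ge> 0" using l by (auto simp: A_def intro!: add_nonneg_nonneg)
  define C1 C2 where "C1 = C * A powr (1/2) + 4 * S / (\<eta> powr (1/4) * l powr (1/2))"
    and "C2 = C * A powr (1/2) + 4 * S / (\<eta> powr (1/2) * l powr (1/2))"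
  have C12: "0 \<le> C1" "0 \<le> C2" using assms(5) \<open>0 < S\<close> by (auto simp: C1_def C2_def)
  have "increment_modulus \<alpha> u T a b \<delta> \<omega> \<le> ereal (C1 + C2)"
  proof (rule increment_modulus_le)
    fix s t x y assume range: "(s, t, x, y) \<in> increment_range T a b \<delta>"
    then have r: "s \<in> {0..T}" "t \<in> {0..T}" "x \<in> {a..b}" "y \<in> {a..b}" and "s \<noteq> t" "x \<noteq> y"
      by (auto simp: increment_range_def)
    define h k where "h = \<bar>t - s\<bar>" and "k = \<bar>x - y\<bar>"
    have hk: "0 < h" "h \<le> T" "0 < k" "k \<le> b - a" using r \<open>s \<noteq> t\<close> \<open>x \<noteq> y\<close> by (auto simp: h_def k_def)
    define L where "L = \<bar>ln (h * k)\<bar>"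
    have "ln (h * k) \<le> - l" using l(2) range unfolding h_def k_def by blast
    then have L: "l \<le> L" "L = - ln h - ln k" using l(1) hk by (auto simp: L_def ln_mult)
    have AL: "L + (\<bar>ln T\<bar> + \<bar>ln (b - a)\<bar>) \<le> A * L"
    proof -
      define B where "B = \<bar>ln T\<bar> + \<bar>ln (b - a)\<bar>"
      have "B / l * l \<le> B / l * L"
        using l(1) L by (intro mult_left_mono) (auto simp: B_def)
      moreover have "B / l * l = B" using l(1) by simp
      moreover have "A * L = L + B / l * L" unfolding A_def B_def[symmetric] by (simp add: algebra_simps)
      ultimately show ?thesis unfolding B_def[symmetric] by linarith
    qed
    have "ln h \<le> ln T" "ln k \<le> ln (b - a)" using hk by auto
    moreover have "ln (1 / h) = - ln h" "ln (1 / k) = - ln k" using hk by (simp_all add: ln_div)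
    ultimately have log: "ln (1 / h) \<le> A * L" "ln (1 / k) \<le> A * L" using AL L(2) by linarith+
    have val: "\<bar>u t' y' \<omega>\<bar> \<le> S" if "t' \<in> {0..T}" "y' \<in> {a..b}" for t' y'
      using S that by auto
    have R: "\<bar>rect_increment u s t x y \<omega>\<bar> \<le> 4 * S"
      using val[of t y] val[of t x] val[of s y] val[of s x] r unfolding rect_increment_def by linarith
    have "\<bar>rect_increment u s t x y \<omega>\<bar> \<le> C1 * (h powr (1/4) * L powr (1/2))"
      unfolding C1_def
    proof (rule extend_local_bound[OF assms(5) _ _ assms(3,4) l(1) L(1) \<open>A \<ge> 0\<close> hk(1) _ R log(1)])
      show "\<bar>rect_increment u s t x y \<omega>\<bar> \<le> C * (h powr (1/4) * ln (1 / h) powr (1/2))" if "h \<le> \<eta>"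
        using bounds r that hk(1) unfolding h_def small_increment_bounds_def by blast
    qed (use \<open>0 < S\<close> in auto)
    also have "\<dots> \<le> (C1 + C2) * (h powr (1/4) * L powr (1/2))"
      using C12 by (intro mult_right_mono) auto
    finally have 1: "\<bar>rect_increment u s t x y \<omega>\<bar> \<le> (C1 + C2) * (h powr (1/4) * L powr (1/2))" .
    have "\<bar>rect_increment u s t x y \<omega>\<bar> \<le> C2 * (k powr (1/2) * L powr (1/2))"
      unfolding C2_def
    proof (rule extend_local_bound[OF assms(5) _ _ assms(3,4) l(1) L(1) \<open>A \<ge> 0\<close> hk(3) _ R log(2)])
      show "\<bar>rect_increment u s t x y \<omega>\<bar> \<le> C * (k powr (1/2) * ln (1 / k) powr (1/2))" if "k \<le> \<eta>"
        using bounds r that hk(3) unfolding k_def small_increment_bounds_def by blast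
    qed (use \<open>0 < S\<close> in auto)
    also have "\<dots> \<le> (C1 + C2) * (k powr (1/2) * L powr (1/2))"
      using C12 by (intro mult_right_mono) auto
    finally have 2: "\<bar>rect_increment u s t x y \<omega>\<bar> \<le> (C1 + C2) * (k powr (1/2) * L powr (1/2))" .
    have "ln (h * k) \<noteq> 0" using L l(1) by (auto simp: L_def)
    with 1 2 show "ln (\<bar>t - s\<bar> * \<bar>x - y\<bar>) \<noteq> 0 \<and>
      \<bar>rect_increment u s t x y \<omega>\<bar> \<le> (C1 + C2) * (\<bar>t - s\<bar> powr (1/4) * \<bar>ln (\<bar>t - s\<bar> * \<bar>x - y\<bar>)\<bar> powr (1/2)) \<and>
      \<bar>rect_increment u s t x y \<omega>\<bar> \<le> (C1 + C2) * (\<bar>x - y\<bar> powr (1/2) * \<bar>ln (\<bar>t - s\<bar> * \<bar>x - y\<bar>)\<bar> powr (1/2))"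
      unfolding h_def k_def L_def by blast
  qed (use assms(1,2) C12 in auto)
  then show ?thesis by blast
qed

lemma continuous_on_increment_quotient:
  assumes cont: "continuous_on ({0..T} \<times> UNIV) (\<lambda>(t, y). u t y \<omega>)"
    and nz: "\<forall>(s, t, x, y) \<in> increment_range T a b \<delta>. ln (\<bar>t - s\<bar> * \<bar>x - y\<bar>) \<noteq> 0"
  shows "continuous_on (increment_range T a b \<delta>) (increment_quotient \<alpha> u \<omega>)"
proof -
  let ?S = "increment_range T a b \<delta>"
  have u: "continuous_on ?S (\<lambda>p. u (f p) (g p) \<omega>)"
    if "continuous_on ?S f" "continuous_on ?S g" "\<And>p. p \<in> ?S \<Longrightarrow> f p \<in> {0..T}" for f g
  proof -
    have pair: "continuous_on ?S (\<lambda>p. (f p, g p))" by (intro continuous_on_Pair that)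
    have "(\<lambda>p. (f p, g p)) ` ?S \<subseteq> {0..T} \<times> UNIV" using that(3) by blast
    from continuous_on_compose2[OF cont pair this] show ?thesis by simp
  qed
  show ?thesis
    unfolding increment_quotient_def case_prod_unfold rect_increment_def
    using nz
    by (intro continuous_intros u) (auto simp: increment_range_def)
qed

lemma SUP_dense_subset:
  fixes f :: "'b::metric_space \<Rightarrow> real"
  assumes "continuous_on S f" "D \<subseteq> S" "S \<subseteq> closure D"
  shows "(SUP p\<in>S. ereal (f p)) = (SUP p\<in>D. ereal (f p))"
proof (rule antisym)
  show "(SUP p\<in>S. ereal (f p)) \<le> (SUP p\<in>D. ereal (f p))"
  proof (rule SUP_least)
    fix p assume "p \<in> S"
    then have "p \<in> closure D" using assms(3) by blast
    then obtain d where d: "\<And>n. d n \<in> D" "d \<longlonglongrightarrow> p"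
      by (auto simp: closure_sequential)
    have "(\<lambda>n. f (d n)) \<longlonglongrightarrow> f p"
      using d(1) assms(2)
      by (intro continuous_on_tendsto_compose[OF assms(1) d(2) \<open>p \<in> S\<close>] always_eventually) blast
    then have "(\<lambda>n. ereal (f (d n))) \<longlonglongrightarrow> ereal (f p)" by simp
    then show "ereal (f p) \<le> (SUP p\<in>D. ereal (f p))"
      by (rule LIMSEQ_le_const2) (auto intro!: SUP_upper d)
  qed
  show "(SUP p\<in>D. ereal (f p)) \<le> (SUP p\<in>S. ereal (f p))"
    using assms(2) by (intro SUP_subset_mono) auto
qed

text \<open>On continuous paths the supremum may be taken over a countable dense set, which makes it measurable.
The bound \<open>c\<close> is this supremum, truncated from below at \<open>0\<close> to keep it away from \<open>- \<infinity>\<close>; it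
is real almost surely, and the default value of \<open>real_of_ereal\<close> matters on a null set only.\<close>

lemma measurable_increment_modulus_bound:
  assumes meas: "\<And>t y. t \<in> {0..T} \<Longrightarrow> u t y \<in> borel_measurable M"
    and cont: "AE \<omega> in M. continuous_on ({0..T} \<times> UNIV) (\<lambda>(t, y). u t y \<omega>)"
    and fin: "AE \<omega> in M. \<exists>c. increment_modulus \<alpha> u T a b \<delta> \<omega> \<le> ereal c"
    and nz: "\<forall>(s, t, x, y) \<in> increment_range T a b \<delta>. ln (\<bar>t - s\<bar> * \<bar>x - y\<bar>) \<noteq> 0"
  shows "\<exists>c \<in> borel_measurable M. AE \<omega> in M. increment_modulus \<alpha> u T a b \<delta> \<omega> \<le> ereal (c \<omega>)"
proof -
  obtain D where D: "countable D" "D \<subseteq> increment_range T a b \<delta>" "increment_range T a b \<delta> \<subseteq> closure D"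
    using separable[of "increment_range T a b \<delta>"] by blast
  define Z where "Z = (\<lambda>\<omega>. SUP p\<in>D. ereal (increment_quotient \<alpha> u \<omega> p))"
  define c where "c = (\<lambda>\<omega>. real_of_ereal (max 0 (Z \<omega>)))"
  have "(\<lambda>\<omega>. increment_quotient \<alpha> u \<omega> p) \<in> borel_measurable M" if "p \<in> D" for p
  proof -
    obtain s t x y where p: "p = (s, t, x, y)" by (cases p)
    have st: "s \<in> {0..T}" "t \<in> {0..T}" using D(2) that by (auto simp: p increment_range_def)
    note [measurable] = meas[OF st(1)] meas[OF st(2)]
    show ?thesis unfolding increment_quotient_def rect_increment_def p by simp
  qed
  then have Zm [measurable]: "Z \<in> borel_measurable M"
    unfolding Z_def using D(1) by (intro borel_measurable_SUP) auto
  have "c \<in> borel_measurable M" unfolding c_def by measurable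
  moreover have "AE \<omega> in M. increment_modulus \<alpha> u T a b \<delta> \<omega> \<le> ereal (c \<omega>)"
    using cont fin
  proof eventually_elim
    case (elim \<omega>)
    have eq: "increment_modulus \<alpha> u T a b \<delta> \<omega> = Z \<omega>"
      unfolding increment_modulus_alt Z_def
      by (intro SUP_dense_subset[OF continuous_on_increment_quotient[where u=u and \<omega>=\<omega>, OF elim(1) nz] D(2,3)])
    obtain C where "Z \<omega> \<le> ereal C" using elim(2) eq by auto
    then have "max 0 (Z \<omega>) \<noteq> \<infinity>" by (auto simp: max_def)
    then have "ereal (c \<omega>) = max 0 (Z \<omega>)"
      unfolding c_def by (subst ereal_real) (auto simp: max_def)
    then show ?case using eq by simp
  qed
  ultimately show ?thesis by blast
qed

theorem theorem5p2:
  fixes \<alpha> :: real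
  assumes "\<alpha> \<in> {0..1/4}"
  shows "\<exists>\<kappa>::real. \<forall>(M :: 'a measure) W u T a b.
    prob_space M \<and> brownian_sheet M W \<and> T > 0 \<and> a < b \<and>
    mild_solution M W T u \<and> continuous_paths M T u \<longrightarrow>
      (\<forall>\<delta>>0. (\<forall>(s, t, x, y) \<in> increment_range T a b \<delta>. ln (\<bar>t - s\<bar> * \<bar>x - y\<bar>) \<noteq> 0) \<longrightarrow>
         (\<exists>c \<in> borel_measurable M. AE \<omega> in M. increment_modulus \<alpha> u T a b \<delta> \<omega> \<le> ereal (c \<omega>))) \<and>
      (AE \<omega> in M. \<exists>L. ((\<lambda>\<delta>. increment_modulus \<alpha> u T a b \<delta> \<omega>) \<longlongrightarrow> L) (at_right 0) \<and> L \<le> ereal \<kappa>)"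
proof (rule exI[of _ modulus_constant], intro allI impI, elim conjE)
  fix M :: "'a measure" and W u and T a b :: real
  assume hyps: "prob_space M" "brownian_sheet M W" "T > 0" "a < b" "mild_solution M W T u" "continuous_paths M T u"
  have \<alpha>: "0 \<le> \<alpha>" "\<alpha> \<le> 1/4" using assms by auto
  note C = modulus_constant_nonneg
  have AE: "AE \<omega> in M. continuous_on ({0..T} \<times> UNIV) (\<lambda>(t, y). u t y \<omega>) \<and>
    (\<exists>\<eta>>0. \<eta> < 1 \<and> small_increment_bounds modulus_constant \<eta> T a b u \<omega>)"
    using hyps by (intro AE_rect_increment_bounds) auto
  show "(\<forall>\<delta>>0. (\<forall>(s, t, x, y) \<in> increment_range T a b \<delta>. ln (\<bar>t - s\<bar> * \<bar>x - y\<bar>) \<noteq> 0) \<longrightarrow>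
         (\<exists>c \<in> borel_measurable M. AE \<omega> in M. increment_modulus \<alpha> u T a b \<delta> \<omega> \<le> ereal (c \<omega>))) \<and>
      (AE \<omega> in M. \<exists>L. ((\<lambda>\<delta>. increment_modulus \<alpha> u T a b \<delta> \<omega>) \<longlongrightarrow> L) (at_right 0) \<and> L \<le> ereal modulus_constant)"
  proof (intro conjI allI impI)
    fix \<delta> :: real
    assume "\<delta> > 0" and nz: "\<forall>(s, t, x, y) \<in> increment_range T a b \<delta>. ln (\<bar>t - s\<bar> * \<bar>x - y\<bar>) \<noteq> 0"
    show "\<exists>c \<in> borel_measurable M. AE \<omega> in M. increment_modulus \<alpha> u T a b \<delta> \<omega> \<le> ereal (c \<omega>)"
    proof (rule measurable_increment_modulus_bound[OF _ _ _ nz])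
      show "u t y \<in> borel_measurable M" if "t \<in> {0..T}" for t y
        using hyps(5) that by (auto simp: mild_solution_def is_wiener_integral_def)
      show "AE \<omega> in M. continuous_on ({0..T} \<times> UNIV) (\<lambda>(t, y). u t y \<omega>)"
        using hyps(6) by (simp add: continuous_paths_def)
      show "AE \<omega> in M. \<exists>c. increment_modulus \<alpha> u T a b \<delta> \<omega> \<le> ereal c"
        using AE
      proof eventually_elim
        case (elim \<omega>)
        then obtain \<eta> where \<eta>: "0 < \<eta>" "\<eta> < 1" and bounds: "small_increment_bounds modulus_constant \<eta> T a b u \<omega>"
          by (elim conjE exE)
        show ?case
          by (rule increment_modulus_finite[where u=u and \<omega>=\<omega>, OF \<alpha> \<eta> C hyps(3,4) \<open>\<delta> > 0\<close> conjunct1[OF elim] bounds nz])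
      qed
    qed
  next
    show "AE \<omega> in M. \<exists>L. ((\<lambda>\<delta>. increment_modulus \<alpha> u T a b \<delta> \<omega>) \<longlongrightarrow> L) (at_right 0) \<and> L \<le> ereal modulus_constant"
      using AE
    proof eventually_elim
      case (elim \<omega>)
      then obtain \<eta> where \<eta>: "0 < \<eta>" "\<eta> < 1" and bounds: "small_increment_bounds modulus_constant \<eta> T a b u \<omega>"
        by (elim conjE exE)
      show ?case by (rule increment_modulus_limit[where u=u and \<omega>=\<omega>, OF \<alpha> \<eta> bounds C])
    qed
  qed
qed

end
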